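(* Let $(T(t))_{t\ge0}$ be a $C_0$-semigroup on a Banach space $X$ with generator $A$, and let $K:[0,\infty)\times X\to X$ be collectively compact and continuous separately in both variables. Let $a:[0,\infty)\to[0,\infty)$ be a non-increasing function with $\lim_{t\to\infty}a(t)=0$. For a bounded set $B\subset X$ consider the condition (C$_B$) for every $x_0\in B$ there exists a solution $x=x(\cdot,x_0)\in C([0,\infty),X)$ of $$x(t,x_0)=T(t)x_0+\int_0^tT(t-s)K(s,x(s,x_0))\,ds,\qquad t\ge0,\qquad( * )$$ such that the set $\{x(t,x_0):0\le t\le\tau,\ x_0\in B\}$ is bounded for each $\tau>0$. Let $X_0\subset X$, $y\in X$, $r>0$ with $\overline{B}(y,r)\subset X_0$, and assume that (C$_B$) holds for $B=\overline{B}(y,r)$. Then there exist $x_0\in\overline{B}(y,r)$, a solution $x(\cdot,x_0)$ of $( * )$, and $t_0\ge0$ such that $$\|x(t,x_0)\|\ge a(t)e^{s_R(A)t},\qquad t\ge t_0.\qquad( ** )$$ If $X_0=X$ and (C$_B$) holds for all bounded subsets $B$ of $X$, then the set of $x_0\in X$ for which $( ** )$ holds (for some solution $x(\cdot,x_0)$ of $( * )$ and some $t_0\ge0$) is dense in $X$.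
   Context: All Banach spaces are complex and infinite-dimensional. $\overline{B}(y,r)$ is the closed ball. $K$ is collectively compact if $K([0,t_0]\times B)$ is precompact in $X$ for each bounded set $B\subset X$ and each $t_0\ge0$. Solutions of $( * )$ are not assumed to be unique. $\sigma_e(A)=\{\lambda\in\mathbb C:\lambda-A\text{ is not Fredholm}\}$, $s_e(A)=\sup\{\operatorname{Re}\lambda:\lambda\in\sigma_e(A)\}$, $\sigma_p(A)$ is the point spectrum, $R(\lambda,A)=(\lambda-A)^{-1}$. The resolvent bound $s_R(A)$ is the infimum of the set of all real $a>s_e(A)$ satisfying $\operatorname{card}(\sigma_p(A)\cap(a+i\mathbb R))<\infty$ and $\limsup_{|b|\to\infty}\|R(a+ib,A)\|<\infty$. If $s_R(A)=-\infty$, then $e^{s_R(A)t}$ is read as $0$ for all $t\ge 0$. *)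

theory Defs
  imports "HOL-Analysis.Analysis"
begin

text \<open>The class \<^class>\<open>banach\<close> is real; a complex Banach space carries in addition a complex
  scalar multiplication that extends the real one.\<close>

class complex_banach = banach +
  fixes scaleC :: "complex \<Rightarrow> 'a \<Rightarrow> 'a" (infixr "*\<^sub>C" 75)
  assumes scaleC_add_right: "c *\<^sub>C (x + y) = c *\<^sub>C x + c *\<^sub>C y"
    and scaleC_add_left: "(c + d) *\<^sub>C x = c *\<^sub>C x + d *\<^sub>C x"
    and scaleC_scaleC: "c *\<^sub>C d *\<^sub>C x = (c * d) *\<^sub>C x"
    and scaleR_scaleC: "r *\<^sub>R x = complex_of_real r *\<^sub>C x"
    and norm_scaleC: "norm (c *\<^sub>C x) = cmod c * norm x"

global_interpretation complex_vector: vector_space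
  "scaleC :: complex \<Rightarrow> 'a \<Rightarrow> 'a::complex_banach"
proof
  fix c d :: complex and x y :: 'a
  show "c *\<^sub>C (x + y) = c *\<^sub>C x + c *\<^sub>C y" by (rule scaleC_add_right)
  show "(c + d) *\<^sub>C x = c *\<^sub>C x + d *\<^sub>C x" by (rule scaleC_add_left)
  show "c *\<^sub>C d *\<^sub>C x = (c * d) *\<^sub>C x" by (rule scaleC_scaleC)
  show "1 *\<^sub>C x = x" using scaleR_scaleC[of 1 x] by simp
qed

definition finite_dimensional :: "'a::complex_banach set \<Rightarrow> bool" where
  "finite_dimensional S \<longleftrightarrow> (\<exists>F. finite F \<and> S \<subseteq> complex_vector.span F)"

definition finite_codimensional :: "'a::complex_banach set \<Rightarrow> bool" where
  "finite_codimensional S \<longleftrightarrow> (\<exists>F. finite F \<and> complex_vector.span (S \<union> F) = UNIV)"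

definition bounded_clinear :: "('a::complex_banach \<Rightarrow> 'a) \<Rightarrow> bool" where
  "bounded_clinear f \<longleftrightarrow> bounded_linear f \<and> (\<forall>c x. f (c *\<^sub>C x) = c *\<^sub>C f x)"

text \<open>Functions on \<open>[0,\<infinity>)\<close> are modelled as functions on \<^typ>\<open>real\<close> whose values at negative
  arguments are irrelevant.\<close>

definition C0_semigroup :: "(real \<Rightarrow> 'a::complex_banach \<Rightarrow> 'a) \<Rightarrow> bool" where
  "C0_semigroup T \<longleftrightarrow>
     (\<forall>t\<ge>0. bounded_clinear (T t)) \<and>
     (\<forall>x. T 0 x = x) \<and>
     (\<forall>s\<ge>0. \<forall>t\<ge>0. \<forall>x. T (s + t) x = T s (T t x)) \<and>
     (\<forall>x. continuous_on {0..} (\<lambda>t. T t x))"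

text \<open>An unbounded operator is given by its domain \<open>D\<close> and a total function \<open>A\<close> whose values
  outside \<open>D\<close> are irrelevant.\<close>

definition generator_domain :: "(real \<Rightarrow> 'a::complex_banach \<Rightarrow> 'a) \<Rightarrow> 'a set" where
  "generator_domain T = {x. \<exists>y. ((\<lambda>h. (T h x - x) /\<^sub>R h) \<longlongrightarrow> y) (at_right 0)}"

definition generator :: "(real \<Rightarrow> 'a::complex_banach \<Rightarrow> 'a) \<Rightarrow> 'a \<Rightarrow> 'a" where
  "generator T x = Lim (at_right 0) (\<lambda>h. (T h x - x) /\<^sub>R h)"

definition fredholm :: "'a::complex_banach set \<Rightarrow> ('a \<Rightarrow> 'a) \<Rightarrow> bool" where
  "fredholm D L \<longleftrightarrow>
     finite_dimensional {x \<in> D. L x = 0} \<and> closed (L ` D) \<and> finite_codimensional (L ` D)"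

definition essential_spectrum :: "'a::complex_banach set \<Rightarrow> ('a \<Rightarrow> 'a) \<Rightarrow> complex set" where
  "essential_spectrum D A = {l. \<not> fredholm D (\<lambda>x. l *\<^sub>C x - A x)}"

definition essential_spectral_bound :: "'a::complex_banach set \<Rightarrow> ('a \<Rightarrow> 'a) \<Rightarrow> ereal" where
  "essential_spectral_bound D A = (SUP l\<in>essential_spectrum D A. ereal (Re l))"

definition point_spectrum :: "'a::complex_banach set \<Rightarrow> ('a \<Rightarrow> 'a) \<Rightarrow> complex set" where
  "point_spectrum D A = {l. \<exists>x\<in>D. x \<noteq> 0 \<and> A x = l *\<^sub>C x}"

definition resolvent :: "'a::complex_banach set \<Rightarrow> ('a \<Rightarrow> 'a) \<Rightarrow> complex \<Rightarrow> 'a \<Rightarrow> 'a" where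
  "resolvent D A l = the_inv_into D (\<lambda>x. l *\<^sub>C x - A x)"

definition resolvent_set :: "'a::complex_banach set \<Rightarrow> ('a \<Rightarrow> 'a) \<Rightarrow> complex set" where
  "resolvent_set D A =
     {l. bij_betw (\<lambda>x. l *\<^sub>C x - A x) D UNIV \<and> bounded_clinear (resolvent D A l)}"

text \<open>The operator norm of \<open>R(a + ib, A)\<close> only makes sense on the resolvent set; hence the
  condition that \<open>a + ib\<close> belongs to it for all sufficiently large \<open>\<bar>b\<bar>\<close>. The filter
  \<open>at_infinity\<close> on \<^typ>\<open>real\<close> is \<open>\<bar>b\<bar> \<rightarrow> \<infinity>\<close>.\<close>

definition resolvent_bound :: "'a::complex_banach set \<Rightarrow> ('a \<Rightarrow> 'a) \<Rightarrow> ereal" where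
  "resolvent_bound D A =
     (INF a\<in>{a::real. essential_spectral_bound D A < ereal a \<and>
                finite (point_spectrum D A \<inter> {l. Re l = a}) \<and>
                (\<forall>\<^sub>F b in at_infinity. Complex a b \<in> resolvent_set D A) \<and>
                Limsup at_infinity (\<lambda>b. ereal (onorm (resolvent D A (Complex a b)))) < \<infinity>}.
        ereal a)"

text \<open>\<open>e\<^sup>s\<^sup>t\<close>, read as \<open>0\<close> for \<open>s = -\<infinity>\<close>. It is applied to resolvent bounds of generators only,
  for which \<open>s < \<infinity>\<close>; the value at \<open>s = \<infinity>\<close> is irrelevant.\<close>

definition exp_growth :: "ereal \<Rightarrow> real \<Rightarrow> real" where
  "exp_growth s t = (if s = -\<infinity> then 0 else exp (real_of_ereal s * t))"

definition collectively_compact :: "(real \<Rightarrow> 'a::complex_banach \<Rightarrow> 'a) \<Rightarrow> bool" where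
  "collectively_compact K \<longleftrightarrow>
     (\<forall>B t0. bounded B \<and> t0 \<ge> 0 \<longrightarrow> compact (closure ((\<lambda>(t, x). K t x) ` ({0..t0} \<times> B))))"

definition separately_continuous :: "(real \<Rightarrow> 'a::complex_banach \<Rightarrow> 'a) \<Rightarrow> bool" where
  "separately_continuous K \<longleftrightarrow>
     (\<forall>x. continuous_on {0..} (\<lambda>t. K t x)) \<and> (\<forall>t\<ge>0. continuous_on UNIV (K t))"

text \<open>The integral is the gauge integral, because the library's Bochner integral requires a
  separable range space. If \<open>K\<close> is collectively compact and separately continuous and \<open>u\<close> is
  continuous, then the integrand is bounded and strongly measurable on \<open>[0,t]\<close>, hence Bochner
  integrable, and the two integrals agree.\<close>

definition is_solution ::
  "(real \<Rightarrow> 'a::complex_banach \<Rightarrow> 'a) \<Rightarrow> (real \<Rightarrow> 'a \<Rightarrow> 'a) \<Rightarrow> 'a \<Rightarrow> (real \<Rightarrow> 'a) \<Rightarrow> bool" where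
  "is_solution T K x0 u \<longleftrightarrow>
     continuous_on {0..} u \<and>
     (\<forall>t\<ge>0. (\<lambda>s. T (t - s) (K s (u s))) integrable_on {0..t} \<and>
            u t = T t x0 + integral {0..t} (\<lambda>s. T (t - s) (K s (u s))))"

definition bounded_solvability ::
  "(real \<Rightarrow> 'a::complex_banach \<Rightarrow> 'a) \<Rightarrow> (real \<Rightarrow> 'a \<Rightarrow> 'a) \<Rightarrow> 'a set \<Rightarrow> bool" where
  "bounded_solvability T K B \<longleftrightarrow>
     (\<exists>x. (\<forall>x0\<in>B. is_solution T K x0 (x x0)) \<and>
          (\<forall>\<tau>>0. bounded {x x0 t | t x0. 0 \<le> t \<and> t \<le> \<tau> \<and> x0 \<in> B}))"

end

theory Submission
  imports Defs "HOL-Library.Ramsey"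
begin

text \<open>A solution is an orbit of \<open>T\<close> plus an integral, and collective compactness makes the integrals up
  to a given time, over all initial values in the ball, a totally bounded set. It therefore suffices
  to find \<open>x0\<close> in the ball such that \<open>T n x0\<close> keeps distance at least \<open>\<alpha> n * exp (s n)\<close> from a
  prescribed totally bounded set \<open>Q n\<close> for all large integers \<open>n\<close>, where \<open>s\<close> is the resolvent bound
  and \<open>\<alpha>\<close> is a null sequence; if the resolvent bound is \<open>-\<infinity>\<close>, there is nothing to prove. The constant lost by passing to integer times is absorbed by \<open>\<alpha>\<close>.

  The spectral input is \<open>separated_below_resolvent_bound\<close>: with a constant \<open>c > 0\<close> not depending
  on \<open>N\<close>, there is for every \<open>N\<close> a sequence in the unit ball whose differences satisfy
  \<open>norm (T n (x i - x j)) \<ge> c * exp (s n)\<close> for all \<open>n \<le> N\<close>. Suppose that this fails for a real number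
  \<open>b\<close>. Eigenvectors to infinitely many eigenvalues with real part at least \<open>b\<close>, a kernel of
  infinite dimension, a range that is not closed, or approximate eigenvectors arbitrarily high up
  on a vertical line would each produce such a sequence, because an approximate eigenvector moves approximately by a
  factor \<open>exp (l t)\<close>. Hence \<open>l - A\<close> is Fredholm for \<open>Re l \<ge> b\<close>, only finitely many eigenvalues lie
  there, and the resolvent exists and is bounded high up on every line \<open>Re l = \<beta> \<ge> b\<close>; so the
  resolvent bound is at most \<open>b\<close>. Surjectivity of \<open>l - A\<close> away from the eigenvalues is carried
  over from a right half-plane by connectedness, and at an eigenvalue the finite codimension of the
  range follows by comparison with nearby points.

  The construction of \<open>x0\<close> (\<open>orbit_escaping_totally_bounded_sets\<close>) adds to the centre of the ball a
  series of small multiples of differences \<open>x j - x i\<close>, one for each block of integers. The size of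
  the summand decides the lower bound that it creates on its block. Later summands must not destroy it,
  although \<open>T n\<close> may enlarge them enormously. This is achieved by \<open>invisible_difference\<close>: among the
  differences of a bounded sequence there is always one which, after applying the operators, decreases
  the norms of finitely many given vectors by at most a prescribed \<open>\<epsilon>\<close>. Ramsey's theorem and a
  telescoping sum prove it, in place of norming functionals.\<close>

section \<open>Ramsey arguments on sequences\<close>

lemma Ramsey_sequence:
  fixes col :: "nat \<Rightarrow> nat \<Rightarrow> 'b"
  assumes "finite C" and "\<And>i j. i < j \<Longrightarrow> col i j \<in> C"
  obtains h :: "nat \<Rightarrow> nat" and c where "strict_mono h" "c \<in> C" "\<And>i j. i < j \<Longrightarrow> col (h i) (h j) = c"
proof -
  obtain g :: "'b \<Rightarrow> nat" where g: "bij_betw g C {0..<card C}"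
    using ex_bij_betw_finite_nat[OF assms(1)] by blast
  define f where "f X = g (col (Min X) (Max X))" for X
  have f: "f {i, j} = g (col i j)" if "i < j" for i j
    using that by (simp add: f_def)
  have part: "\<forall>x\<in>UNIV. \<forall>y\<in>UNIV. x \<noteq> y \<longrightarrow> f {x, y} < card C"
  proof (intro ballI impI)
    fix x y :: nat assume "x \<noteq> y"
    have *: "f {x, y} < card C" if "x < y" for x y
      using assms(2)[OF that] f[OF that] g by (auto simp: bij_betw_def)
    show "f {x, y} < card C"
      using *[of x y] *[of y x] \<open>x \<noteq> y\<close> by (metis insert_commute linorder_neqE_nat)
  qed
  obtain Y t where Y: "infinite Y" "\<And>x y. x \<in> Y \<Longrightarrow> y \<in> Y \<Longrightarrow> x \<noteq> y \<Longrightarrow> f {x, y} = t"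
    using Ramsey2[OF infinite_UNIV_nat part] by metis
  obtain h :: "nat \<Rightarrow> nat" where h: "strict_mono h" "\<And>n. h n \<in> Y"
    using infinite_enumerate[OF Y(1)] by blast
  have gt: "g (col (h i) (h j)) = t" if "i < j" for i j
    using f[OF strict_monoD[OF h(1) that]] Y(2)[OF h(2) h(2), of i j] strict_monoD[OF h(1) that]
    by simp
  have mem: "col (h i) (h j) \<in> C" if "i < j" for i j
    using assms(2) strict_monoD[OF h(1) that] by blast
  have "col (h i) (h j) = col (h 0) (h 1)" if "i < j" for i j
    using g gt[OF that] gt[of 0 1] mem[OF that] mem[of 0 1]
    by (metis bij_betw_imp_inj_on inj_onD zero_less_one)
  moreover have "col (h 0) (h 1) \<in> C" using mem[of 0 1] by simp
  ultimately show thesis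
    using that[OF h(1)] by blast
qed

text \<open>This builds a sequence step by step: every new index is good together with all indices up to the
last one chosen, hence with all those chosen before.\<close>

lemma subsequence_of_good_pairs:
  fixes P :: "nat \<Rightarrow> nat \<Rightarrow> bool"
  assumes "\<And>m. \<exists>n>m. \<forall>i\<le>m. P i n"
  obtains h :: "nat \<Rightarrow> nat" where "strict_mono h" "\<And>i j. i < j \<Longrightarrow> P (h i) (h j)"
proof -
  obtain s where s: "\<And>m. s m > m" "\<And>m i. i \<le> m \<Longrightarrow> P i (s m)"
    using assms by metis
  define h where "h = rec_nat 0 (\<lambda>_. s)"
  have hS: "h (Suc k) = s (h k)" for k by (simp add: h_def)
  have h: "strict_mono h"
    by (simp add: strict_mono_Suc_iff hS s(1))
  moreover have "P (h i) (h j)" if "i < j" for i j :: nat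
  proof -
    obtain k where k: "j = Suc k" "i \<le> k" using \<open>i < j\<close> by (cases j) auto
    have "h i \<le> h k" using h k(2) by (simp add: strict_mono_less_eq)
    then show ?thesis
      using s(2)[of "h i" "h k"] k(1) by (simp add: hS)
  qed
  ultimately show thesis by (rule that)
qed

text \<open>If every subsequence contains two close terms, then the range is totally bounded, since otherwise a
separated subsequence could be chosen greedily.\<close>

lemma convergent_subsequence:
  fixes x :: "nat \<Rightarrow> 'a::complete_space"
  assumes "\<And>e h. e > 0 \<Longrightarrow> strict_mono h \<Longrightarrow> \<exists>i j::nat. i < j \<and> dist (x (h i)) (x (h j)) < e"
  obtains h :: "nat \<Rightarrow> nat" and l where "strict_mono h" "(x \<circ> h) \<longlonglongrightarrow> l"
proof -
  have tb: "\<exists>k. finite k \<and> closure (range x) \<subseteq> (\<Union>y\<in>k. ball y e)" if "e > 0" for e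
  proof (rule ccontr)
    assume no: "\<not> ?thesis"
    have "\<exists>n>m. \<forall>i\<le>m. dist (x i) (x n) \<ge> e/2" for m
    proof (rule ccontr)
      assume "\<not> ?thesis"
      then have *: "\<exists>i\<le>m. dist (x i) (x n) < e/2" for n
        using \<open>e > 0\<close> by (cases "n \<le> m") (auto simp: not_le intro!: exI[of _ n])
      have "closure (range x) \<subseteq> (\<Union>y\<in>x ` {..m}. ball y e)"
      proof
        fix z assume "z \<in> closure (range x)"
        then obtain n where "dist (x n) z < e/2"
          using \<open>e > 0\<close> by (metis (no_types, opaque_lifting) closure_approachable half_gt_zero rangeE)
        moreover obtain i where "i \<le> m" "dist (x i) (x n) < e/2" using * by blast
        ultimately show "z \<in> (\<Union>y\<in>x ` {..m}. ball y e)"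
          using dist_triangle[of "x i" z "x n"] by (auto intro!: bexI[of _ i])
      qed
      with no show False by blast
    qed
    then obtain h :: "nat \<Rightarrow> nat"
      where h: "strict_mono h" "\<And>i j. i < j \<Longrightarrow> dist (x (h i)) (x (h j)) \<ge> e/2"
      using subsequence_of_good_pairs[of "\<lambda>i n. dist (x i) (x n) \<ge> e/2"] by metis
    then show False
      using assms[of "e/2" h] \<open>e > 0\<close> by fastforce
  qed
  have "compact (closure (range x))"
    unfolding compact_eq_totally_bounded using tb by (auto simp: complete_eq_closed)
  then obtain l h where "strict_mono h" "(x \<circ> h) \<longlonglongrightarrow> l"
    using closure_subset[of "range x"] unfolding compact_def by blast
  then show thesis by (rule that)
qed

section \<open>Riesz sequences modulo a closed subspace\<close>

abbreviation cspan :: "'a::complex_banach set \<Rightarrow> 'a set" where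
  "cspan \<equiv> complex_vector.span"

abbreviation csubspace :: "'a::complex_banach set \<Rightarrow> bool" where
  "csubspace \<equiv> complex_vector.subspace"

lemma norm_minus_scaled_ge_infdist:
  assumes S: "csubspace S" and "u \<in> S"
  shows "cmod a * infdist x S \<le> norm (u - a *\<^sub>C x)"
proof (cases "a = 0")
  case False
  have "(1/a) *\<^sub>C u \<in> S"
    using assms by (simp add: complex_vector.subspace_scale)
  then have "infdist x S \<le> norm (x - (1/a) *\<^sub>C u)"
    using infdist_le[of "(1/a) *\<^sub>C u" S x] by (simp add: dist_norm)
  then have "cmod a * infdist x S \<le> norm (a *\<^sub>C (x - (1/a) *\<^sub>C u))"
    by (simp add: norm_scaleC mult_left_mono)
  also have "a *\<^sub>C (x - (1/a) *\<^sub>C u) = - (u - a *\<^sub>C x)"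
    using False by (simp add: complex_vector.scale_right_diff_distrib)
  finally show ?thesis by (simp add: norm_minus_commute)
qed auto

lemma bounded_bilinear_scaleC:
  "bounded_bilinear (scaleC :: complex \<Rightarrow> 'a::complex_banach \<Rightarrow> 'a)"
proof
  fix a b :: complex and x y :: 'a and r :: real
  show "(a + b) *\<^sub>C x = a *\<^sub>C x + b *\<^sub>C x" by (rule scaleC_add_left)
  show "a *\<^sub>C (x + y) = a *\<^sub>C x + a *\<^sub>C y" by (rule scaleC_add_right)
  show "(r *\<^sub>R a) *\<^sub>C x = r *\<^sub>R (a *\<^sub>C x)"
    by (simp add: scaleR_scaleC scaleC_scaleC scaleR_conv_of_real)
  show "a *\<^sub>C r *\<^sub>R x = r *\<^sub>R (a *\<^sub>C x)"
    by (simp add: scaleR_scaleC scaleC_scaleC mult.commute)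
  show "\<exists>K. \<forall>(a::complex) (x::'a). norm (a *\<^sub>C x) \<le> norm a * norm x * K"
    by (intro exI[of _ 1]) (simp add: norm_scaleC)
qed

lemma tendsto_scaleC:
  fixes x :: "'b \<Rightarrow> 'a::complex_banach"
  assumes "(c \<longlongrightarrow> l) F" "(x \<longlongrightarrow> y) F"
  shows "((\<lambda>k. c k *\<^sub>C x k) \<longlongrightarrow> l *\<^sub>C y) F"
  by (rule bounded_bilinear.tendsto[OF bounded_bilinear_scaleC assms])

text \<open>If \<open>x\<close> lies outside the closed span \<open>S\<close>, its coefficient in an element of the larger span is controlled
by the norm of that element divided by the distance from \<open>x\<close> to \<open>S\<close>. So coefficients of a convergent
sequence converge.\<close>

lemma closed_span_insert:
  assumes "closed (cspan S)"
  shows "closed (cspan (insert x S))"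
proof (cases "x \<in> cspan S")
  case True
  then show ?thesis using assms by (simp add: complex_vector.span_redundant)
next
  case False
  define d where "d = infdist x (cspan S)"
  have ne: "cspan S \<noteq> {}" using complex_vector.span_zero by blast
  have d: "d > 0"
    using in_closed_iff_infdist_zero[OF assms ne, of x] False infdist_nonneg[of x "cspan S"]
    by (simp add: d_def)
  have sub: "csubspace (cspan S)" by (rule complex_vector.subspace_span)
  show ?thesis
  proof (unfold closed_sequential_limits, intro allI impI)
    fix z l assume "(\<forall>n. z n \<in> cspan (insert x S)) \<and> z \<longlonglongrightarrow> l"
    then have z: "\<And>n. z n \<in> cspan (insert x S)" and l: "z \<longlonglongrightarrow> l" by auto
    obtain c where c: "\<And>n. z n - c n *\<^sub>C x \<in> cspan S"
      using z unfolding complex_vector.span_insert by auto metis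
    have "Cauchy c"
    proof (rule CauchyI)
      fix e :: real assume "e > 0"
      then obtain M where M: "\<And>m n. m \<ge> M \<Longrightarrow> n \<ge> M \<Longrightarrow> norm (z m - z n) < e * d"
        using LIMSEQ_imp_Cauchy[OF l] d unfolding Cauchy_iff by (metis mult_pos_pos)
      have "norm (c m - c n) < e" if "m \<ge> M" "n \<ge> M" for m n
      proof -
        have u: "(z m - c m *\<^sub>C x) - (z n - c n *\<^sub>C x) \<in> cspan S"
          using c complex_vector.span_diff by blast
        have "cmod (c n - c m) * d \<le>
            norm ((z m - c m *\<^sub>C x) - (z n - c n *\<^sub>C x) - (c n - c m) *\<^sub>C x)"
          unfolding d_def by (rule norm_minus_scaled_ge_infdist[OF sub u])
        also have "\<dots> = norm (z m - z n)"
          by (simp add: complex_vector.scale_left_diff_distrib)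
        also have "\<dots> < e * d" using M that by blast
        finally show ?thesis using d by (simp add: norm_minus_commute)
      qed
      then show "\<exists>M. \<forall>m\<ge>M. \<forall>n\<ge>M. norm (c m - c n) < e" by blast
    qed
    then obtain a where a: "c \<longlonglongrightarrow> a" using Cauchy_convergent convergent_def by blast
    have "(\<lambda>n. z n - c n *\<^sub>C x) \<longlonglongrightarrow> l - a *\<^sub>C x"
      using l tendsto_scaleC[OF a tendsto_const] by (rule tendsto_diff)
    then have "l - a *\<^sub>C x \<in> cspan S"
      using assms c unfolding closed_sequential_limits by (metis (no_types, lifting))
    then show "l \<in> cspan (insert x S)" unfolding complex_vector.span_insert by blast
  qed
qed

lemma closed_span_Un_finite:
  assumes "closed (cspan S)" "finite F"
  shows "closed (cspan (S \<union> F))"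
  using assms(2) by induction (use assms(1) closed_span_insert in auto)

text \<open>Riesz's lemma with the almost orthogonal unit vector written as \<open>a x - u\<close>. The explicit form shows
that this vector lies in every subspace containing \<open>S\<close> and \<open>x\<close>.\<close>

lemma riesz_lemma:
  assumes S: "csubspace S" "closed S" and "x \<notin> S"
  obtains a u where "a \<noteq> 0" "u \<in> S" "norm (a *\<^sub>C x - u) = 1"
    "\<And>v. v \<in> S \<Longrightarrow> norm (a *\<^sub>C x - u - v) \<ge> 1/2"
proof -
  have ne: "S \<noteq> {}" using S(1) complex_vector.subspace_0 by blast
  define d where "d = infdist x S"
  have d: "d > 0"
    using in_closed_iff_infdist_zero[OF S(2) ne, of x] \<open>x \<notin> S\<close> infdist_nonneg[of x S]
    by (simp add: d_def)
  obtain w where w: "w \<in> S" "norm (x - w) < 2 * d"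
  proof -
    have "infdist x S < 2 * d" using d by (simp add: d_def)
    then have "(INF w\<in>S. dist x w) < 2 * d" using ne by (simp add: infdist_def)
    moreover have "bdd_below (dist x ` S)" by (rule bdd_belowI2[of _ 0]) simp
    ultimately obtain w where "w \<in> S" "dist x w < 2 * d"
      using cINF_less_iff[OF ne] by blast
    then show thesis using that by (simp add: dist_norm)
  qed
  define n where "n = norm (x - w)"
  have n: "n > 0" "n < 2 * d" using w \<open>x \<notin> S\<close> by (auto simp: n_def)
  define a where "a = complex_of_real (1/n)"
  have na: "cmod a = 1/n" using n by (simp add: a_def norm_divide)
  have eq: "a *\<^sub>C x - a *\<^sub>C w = a *\<^sub>C (x - w)" by (simp add: complex_vector.scale_right_diff_distrib)
  have "1/2 \<le> norm (a *\<^sub>C x - a *\<^sub>C w - v)" if "v \<in> S" for v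
  proof -
    have "a *\<^sub>C w + v \<in> S"
      using S(1) w(1) that by (simp add: complex_vector.subspace_add complex_vector.subspace_scale)
    from norm_minus_scaled_ge_infdist[OF S(1) this, of a x]
    have "d / n \<le> norm (a *\<^sub>C w + v - a *\<^sub>C x)" by (simp add: na d_def)
    moreover have "1/2 \<le> d / n" using n by (simp add: field_simps)
    ultimately show ?thesis
      by (metis add.commute diff_diff_eq norm_minus_commute order_trans)
  qed
  moreover have "norm (a *\<^sub>C x - a *\<^sub>C w) = 1"
    unfolding eq norm_scaleC na using n by (simp add: n_def)
  ultimately show thesis
    using that[of a "a *\<^sub>C w"] S(1) w(1) n by (auto simp: a_def complex_vector.subspace_scale)
qed

text \<open>If \<open>Z\<close> has infinite dimension modulo \<open>Y\<close>, iterating Riesz's lemma inside \<open>Z\<close> gives unit vectors whose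
differences stay away from \<open>Y\<close>. With \<open>Y = {}\<close> this is the usual separated sequence in an
infinite-dimensional space.\<close>

lemma riesz_sequence:
  fixes Z :: "'a::complex_banach set"
  assumes "csubspace Z" and "Y \<subseteq> Z" and "closed (cspan Y)"
    and inf: "\<And>F. finite F \<Longrightarrow> \<not> Z \<subseteq> cspan (Y \<union> F)"
  obtains z :: "nat \<Rightarrow> 'a" where "\<And>n. z n \<in> Z" "\<And>n. norm (z n) = 1"
    "\<And>i j v. i < j \<Longrightarrow> v \<in> cspan Y \<Longrightarrow> norm (z j - z i - v) \<ge> 1/2"
proof -
  have ex: "\<exists>z. z \<in> Z \<and> norm z = 1 \<and> (\<forall>v\<in>cspan (Y \<union> F). norm (z - v) \<ge> 1/2)"
    if F: "finite F" "F \<subseteq> Z" for F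
  proof -
    obtain x where x: "x \<in> Z" "x \<notin> cspan (Y \<union> F)" using inf[OF F(1)] by blast
    obtain a u where au: "u \<in> cspan (Y \<union> F)" "norm (a *\<^sub>C x - u) = 1"
      "\<And>v. v \<in> cspan (Y \<union> F) \<Longrightarrow> norm (a *\<^sub>C x - u - v) \<ge> 1/2"
      using riesz_lemma[OF complex_vector.subspace_span closed_span_Un_finite[OF assms(3) F(1)] x(2)]
      by metis
    have "u \<in> Z"
      using au(1) complex_vector.span_minimal[of "Y \<union> F" Z] assms F by blast
    then have "a *\<^sub>C x - u \<in> Z"
      using assms(1) x(1) by (simp add: complex_vector.subspace_diff complex_vector.subspace_scale)
    with au show ?thesis by blast
  qed
  define next_z where "next_z F = (SOME z. z \<in> Z \<and> norm z = 1 \<and>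
    (\<forall>v\<in>cspan (Y \<union> F). norm (z - v) \<ge> 1/2))" for F
  have nz: "next_z F \<in> Z" "norm (next_z F) = 1"
      "\<And>v. v \<in> cspan (Y \<union> F) \<Longrightarrow> norm (next_z F - v) \<ge> 1/2"
    if "finite F" "F \<subseteq> Z" for F
    using someI_ex[OF ex[OF that]] unfolding next_z_def by blast+
  define E where "E = rec_nat {} (\<lambda>_ F. insert (next_z F) F)"
  have E0: "E 0 = {}" and ES: "E (Suc n) = insert (next_z (E n)) (E n)" for n
    by (simp_all add: E_def)
  have E: "finite (E n) \<and> E n \<subseteq> Z" for n
    by (induction n) (use E0 ES nz in auto)
  have mono: "E i \<subseteq> E j" if "i \<le> j" for i j
    using that by (induction rule: dec_induct) (auto simp: ES)
  define z where "z n = next_z (E n)" for n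
  show thesis
  proof (rule that[of z])
    fix n show "z n \<in> Z" "norm (z n) = 1" using nz E by (auto simp: z_def)
  next
    fix i j :: nat and v assume "i < j" "v \<in> cspan Y"
    then have "z i \<in> E j" using mono[of "Suc i" j] by (auto simp: z_def ES)
    then have "z i + v \<in> cspan (Y \<union> E j)"
      using \<open>v \<in> cspan Y\<close> complex_vector.span_mono[of Y "Y \<union> E j"]
      by (meson UnCI complex_vector.span_add complex_vector.span_base subsetD sup_ge1)
    then show "norm (z j - z i - v) \<ge> 1/2"
      using nz(3)[of "E j" "z i + v"] E by (simp add: z_def diff_diff_eq)
  qed
qed
section \<open>Uniform boundedness and small perturbations of the identity\<close>

text \<open>The Banach--Steinhaus theorem. By Baire's theorem one of the closed sets on which all operators are
bounded by \<open>k\<close> contains a ball, and boundedness on a ball bounds the norms.\<close>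

lemma uniform_boundedness:
  fixes F :: "'i \<Rightarrow> 'a::banach \<Rightarrow> 'b::real_normed_vector"
  assumes lin: "\<And>i. i \<in> I \<Longrightarrow> bounded_linear (F i)"
    and bdd: "\<And>x. \<exists>c. \<forall>i\<in>I. norm (F i x) \<le> c"
  obtains M where "M \<ge> 1" "\<And>i x. i \<in> I \<Longrightarrow> norm (F i x) \<le> M * norm x"
proof -
  define E where "E k = {x. \<forall>i\<in>I. norm (F i x) \<le> real k}" for k :: nat
  have closed: "closed (E k)" for k
  proof -
    have "E k = (\<Inter>i\<in>I. {x. norm (F i x) \<le> real k})" by (auto simp: E_def)
    moreover have "closed {x. norm (F i x) \<le> real k}" if "i \<in> I" for i
      using linear_continuous_on[OF lin[OF that], of UNIV]
      by (intro closed_Collect_le continuous_intros)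
    ultimately show ?thesis by auto
  qed
  have cover: "(\<Union>k. E k) = UNIV"
  proof -
    have "\<exists>k. x \<in> E k" for x
    proof -
      obtain c where "\<forall>i\<in>I. norm (F i x) \<le> c" using bdd by blast
      moreover obtain k :: nat where "c \<le> real k" using real_arch_simple by blast
      ultimately show ?thesis by (auto simp: E_def intro!: exI[of _ k])
    qed
    then show ?thesis by blast
  qed
  have "\<exists>k. interior (E k) \<noteq> {}"
  proof (rule ccontr)
    assume "\<not> ?thesis"
    then have "interior (\<Union>(range E)) = {}"
      using Met_TC.metric_Baire_category_alt[where 'a='a and \<G>="range E"] closed
      by (auto simp: complete_UNIV)
    then show False using cover by simp
  qed
  then obtain k y where "y \<in> interior (E k)" by blast
  then obtain r where r: "r > 0" "cball y r \<subseteq> E k"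
    using mem_interior_cball by blast
  define M where "M = max 1 (2 * real k / r)"
  have "norm (F i x) \<le> M * norm x" if i: "i \<in> I" for i x
  proof (cases "x = 0")
    case True
    then show ?thesis using linear_simps[OF lin[OF i]] by simp
  next
    case False
    interpret bounded_linear "F i" by (rule lin[OF i])
    define z where "z = (r / norm x) *\<^sub>R x"
    have nz: "norm z = r" using False r by (simp add: z_def)
    have "y + z \<in> E k" "y \<in> E k" using r nz by (auto simp: subset_iff dist_norm)
    then have "norm (F i (y + z)) \<le> real k" "norm (F i y) \<le> real k" using i by (auto simp: E_def)
    then have "norm (F i z) \<le> 2 * real k"
      using norm_triangle_ineq4[of "F i (y + z)" "F i y"] by (simp add: add)
    moreover have "norm (F i z) = r / norm x * norm (F i x)"
      using r by (simp add: z_def scaleR)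
    ultimately have "norm (F i x) \<le> 2 * real k / r * norm x"
      using r False by (simp add: field_simps)
    also have "\<dots> \<le> M * norm x" by (intro mult_right_mono) (auto simp: M_def)
    finally show ?thesis .
  qed
  then show thesis by (intro that[of M]) (auto simp: M_def)
qed

text \<open>Banach's fixed point theorem applied to \<open>x \<mapsto> V x + y\<close>; it replaces the Neumann series.\<close>

lemma contraction_surj:
  fixes V :: "'a::banach \<Rightarrow> 'a"
  assumes "bounded_linear V" "q < 1" "\<And>x. norm (V x) \<le> q * norm x"
  shows "\<exists>x. x - V x = y"
proof -
  interpret bounded_linear V by fact
  have "\<exists>!x. V x + y = x"
  proof (rule banach_fix_type)
    show "\<forall>x z. dist (V x + y) (V z + y) \<le> max 0 q * dist x z"
    proof (intro allI)
      fix x z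
      have "norm (V (x - z)) \<le> q * norm (x - z)" by (rule assms(3))
      also have "\<dots> \<le> max 0 q * norm (x - z)" by (intro mult_right_mono) auto
      finally show "dist (V x + y) (V z + y) \<le> max 0 q * dist x z"
        by (simp add: dist_norm diff)
    qed
  qed (use assms in auto)
  then obtain x where "V x + y = x" by blast
  then show ?thesis by (metis add_diff_cancel_left')
qed

section \<open>Generators of strongly continuous semigroups\<close>

text \<open>The rescaled semigroup is generated by \<open>A - l\<close>. It transfers statements about \<open>A\<close> itself to all the
operators \<open>l - A\<close>.\<close>

definition rescaled :: "complex \<Rightarrow> (real \<Rightarrow> 'a::complex_banach \<Rightarrow> 'a) \<Rightarrow> real \<Rightarrow> 'a \<Rightarrow> 'a" where
  "rescaled l T t x = exp (- l * of_real t) *\<^sub>C T t x"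

locale strongly_continuous_semigroup =
  fixes T :: "real \<Rightarrow> 'a::complex_banach \<Rightarrow> 'a"
  assumes semigroup: "C0_semigroup T"
begin

abbreviation "D \<equiv> generator_domain T"
abbreviation "A \<equiv> generator T"

lemma bounded_linear_T: "t \<ge> 0 \<Longrightarrow> bounded_linear (T t)"
  and T_scaleC: "t \<ge> 0 \<Longrightarrow> T t (c *\<^sub>C x) = c *\<^sub>C T t x"
  and T_0 [simp]: "T 0 x = x"
  and T_add: "s \<ge> 0 \<Longrightarrow> t \<ge> 0 \<Longrightarrow> T (s + t) x = T s (T t x)"
  and continuous_on_T: "continuous_on {0..} (\<lambda>t. T t x)"
  using semigroup by (auto simp: C0_semigroup_def bounded_clinear_def)

lemmas T_linear = bounded_linear.linear[OF bounded_linear_T]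

lemma T_bounded:
  assumes "\<tau> \<ge> 0"
  obtains M where "M \<ge> 1" "\<And>t x. 0 \<le> t \<Longrightarrow> t \<le> \<tau> \<Longrightarrow> norm (T t x) \<le> M * norm x"
proof -
  have "\<exists>c. \<forall>t\<in>{0..\<tau>}. norm (T t x) \<le> c" for x
  proof -
    have "compact ((\<lambda>t. T t x) ` {0..\<tau>})"
      by (intro compact_continuous_image continuous_on_subset[OF continuous_on_T]) auto
    then show ?thesis using compact_imp_bounded[THEN bounded_iff[THEN iffD1]] by fastforce
  qed
  then obtain M where "M \<ge> 1" "\<And>t x. t \<in> {0..\<tau>} \<Longrightarrow> norm (T t x) \<le> M * norm x"
    using uniform_boundedness[of "{0..\<tau>}" T] bounded_linear_T by auto
  then show thesis using that by auto
qed

lemma generator_tendsto: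
  assumes "x \<in> D"
  shows "((\<lambda>h. (T h x - x) /\<^sub>R h) \<longlongrightarrow> A x) (at_right 0)"
proof -
  obtain y where y: "((\<lambda>h. (T h x - x) /\<^sub>R h) \<longlongrightarrow> y) (at_right 0)"
    using assms unfolding generator_domain_def by blast
  then have "A x = y"
    unfolding generator_def by (rule tendsto_Lim[OF trivial_limit_at_right_real])
  with y show ?thesis by simp
qed

lemma generatorI:
  assumes "((\<lambda>h. (T h x - x) /\<^sub>R h) \<longlongrightarrow> y) (at_right 0)"
  shows "x \<in> D" "A x = y"
  using assms tendsto_Lim[OF trivial_limit_at_right_real assms]
  unfolding generator_domain_def generator_def by auto

lemma generator_add:
  assumes "x \<in> D" "y \<in> D"
  shows "x + y \<in> D" "A (x + y) = A x + A y"
proof -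
  have "((\<lambda>h. (T h x - x) /\<^sub>R h + (T h y - y) /\<^sub>R h) \<longlongrightarrow> A x + A y) (at_right 0)"
    using assms by (intro tendsto_intros generator_tendsto)
  moreover have "\<forall>\<^sub>F h in at_right 0. (T h x - x) /\<^sub>R h + (T h y - y) /\<^sub>R h = (T h (x + y) - (x + y)) /\<^sub>R h"
    by (rule eventually_at_right_less[THEN eventually_mono])
      (simp add: linear_add[OF T_linear] algebra_simps)
  ultimately have "((\<lambda>h. (T h (x + y) - (x + y)) /\<^sub>R h) \<longlongrightarrow> A x + A y) (at_right 0)"
    by (rule Lim_transform_eventually)
  then show "x + y \<in> D" "A (x + y) = A x + A y" by (auto dest: generatorI)
qed

lemma generator_scale:
  assumes "x \<in> D"
  shows "c *\<^sub>C x \<in> D" "A (c *\<^sub>C x) = c *\<^sub>C A x"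
proof -
  have "((\<lambda>h. c *\<^sub>C ((T h x - x) /\<^sub>R h)) \<longlongrightarrow> c *\<^sub>C A x) (at_right 0)"
    using assms by (intro tendsto_scaleC tendsto_const generator_tendsto)
  moreover have "\<forall>\<^sub>F h in at_right 0. c *\<^sub>C ((T h x - x) /\<^sub>R h) = (T h (c *\<^sub>C x) - c *\<^sub>C x) /\<^sub>R h"
    by (rule eventually_at_right_less[THEN eventually_mono])
      (simp add: T_scaleC scaleR_scaleC scaleC_scaleC mult.commute
        flip: complex_vector.scale_right_diff_distrib)
  ultimately have "((\<lambda>h. (T h (c *\<^sub>C x) - c *\<^sub>C x) /\<^sub>R h) \<longlongrightarrow> c *\<^sub>C A x) (at_right 0)"
    by (rule Lim_transform_eventually)
  then show "c *\<^sub>C x \<in> D" "A (c *\<^sub>C x) = c *\<^sub>C A x" by (auto dest: generatorI)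
qed

lemma generator_0: "0 \<in> D" "A 0 = 0"
proof -
  have "((\<lambda>h. (T h 0 - 0) /\<^sub>R h) \<longlongrightarrow> 0) (at_right 0)"
    by (rule Lim_transform_eventually[OF tendsto_const],
        rule eventually_at_right_less[THEN eventually_mono])
      (simp add: linear_0[OF T_linear])
  then show "0 \<in> D" "A 0 = 0" by (rule generatorI)+
qed

lemma csubspace_D: "csubspace D"
  by (intro complex_vector.subspaceI generator_0 generator_add generator_scale)

lemma generator_diff:
  assumes "x \<in> D" "y \<in> D"
  shows "A (x - y) = A x - A y"
  using generator_add(2)[OF assms(1) generator_scale(1)[OF assms(2), of "-1"]]
    generator_scale(2)[OF assms(2), of "-1"] by simp

lemma T_diff: "t \<ge> 0 \<Longrightarrow> T t (x - y) = T t x - T t y"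
  by (rule linear_diff[OF T_linear])

text \<open>Cutting \<open>[0,t]\<close> into \<open>n\<close> steps of length \<open>h\<close> bounds the displacement by \<open>n M norm (T h x - x)\<close>, and
\<open>n = t / h\<close>. Letting \<open>h\<close> tend to zero gives the estimate without integrating the orbit.\<close>

lemma orbit_displacement_le:
  assumes "x \<in> D" "0 \<le> t" and M: "\<And>s z. 0 \<le> s \<Longrightarrow> s \<le> t \<Longrightarrow> norm (T s z) \<le> M * norm z"
  shows "norm (T t x - x) \<le> t * M * norm (A x)"
proof (cases "t = 0")
  case False
  then have t: "t > 0" using assms by simp
  define h where "h n = t / real (Suc n)" for n
  have h: "h n > 0" for n using t by (simp add: h_def)
  have step: "norm (T t x - x) \<le> t * M * norm ((T (h n) x - x) /\<^sub>R h n)" for n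
  proof -
    have *: "T (real k * h n) x - x = (\<Sum>j<k. T (real j * h n) (T (h n) x - x))" for k
    proof (induction k)
      case (Suc k)
      have "T (real (Suc k) * h n) x = T (real k * h n) (T (h n) x)"
        using T_add[of "real k * h n" "h n" x] h[of n] by (simp add: algebra_simps)
      then have "T (real (Suc k) * h n) x - x
          = T (real k * h n) (T (h n) x - x) + (T (real k * h n) x - x)"
        using h[of n] by (simp add: T_diff)
      then show ?case using Suc by simp
    qed simp
    have eq: "real (Suc n) * h n = t" by (simp add: h_def)
    have "norm (T t x - x) \<le> (\<Sum>j<Suc n. norm (T (real j * h n) (T (h n) x - x)))"
      using *[of "Suc n"] norm_sum unfolding eq by metis
    also have "\<dots> \<le> (\<Sum>j<Suc n. M * norm (T (h n) x - x))"
    proof (rule sum_mono)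
      fix j assume "j \<in> {..<Suc n}"
      then have "real j * h n \<le> real (Suc n) * h n" using h[of n] by (intro mult_right_mono) auto
      then show "norm (T (real j * h n) (T (h n) x - x)) \<le> M * norm (T (h n) x - x)"
        unfolding eq using h[of n] by (intro M) auto
    qed
    also have "\<dots> = t * M * norm ((T (h n) x - x) /\<^sub>R h n)"
      using t by (simp add: h_def)
    finally show ?thesis .
  qed
  have "h \<longlonglongrightarrow> 0"
    unfolding h_def using LIMSEQ_Suc[OF lim_const_over_n[of t]] by simp
  then have "filterlim h (at_right 0) sequentially"
    unfolding filterlim_at using h by (auto simp: less_imp_neq[THEN not_sym] intro!: always_eventually)
  then have "(\<lambda>n. (T (h n) x - x) /\<^sub>R h n) \<longlonglongrightarrow> A x"
    by (rule filterlim_compose[OF generator_tendsto[OF assms(1)]])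
  then have "(\<lambda>n. t * M * norm ((T (h n) x - x) /\<^sub>R h n)) \<longlonglongrightarrow> t * M * norm (A x)"
    by (intro tendsto_intros)
  then show ?thesis
    by (rule LIMSEQ_le_const) (use step in auto)
qed simp

text \<open>Shifting the interval of integration turns \<open>T h - 1\<close> applied to the integral into the difference of
two integrals over intervals of length \<open>h\<close> at the two ends.\<close>

lemma generator_orbit_integral:
  assumes "t \<ge> 0"
  shows "integral {0..t} (\<lambda>s. T s x) \<in> D" "A (integral {0..t} (\<lambda>s. T s x)) = T t x - x"
proof -
  (* The semigroup law gives T h (F t) = F (t + h) - F h; then (T h (F t) - F t) / h is a
  difference of two right difference quotients of F, at t and at 0. *)
  define F where "F u = integral {0..u} (\<lambda>s. T s x)" for u
  have cont: "continuous_on {a..b} (\<lambda>s. T s x)" if "0 \<le> a" for a b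
    using that by (intro continuous_on_subset[OF continuous_on_T]) auto
  have F: "((\<lambda>s. T s x) has_integral F b - F a) {a..b}" if "0 \<le> a" "a \<le> b" for a b
  proof -
    have "F a + integral {a..b} (\<lambda>s. T s x) = F b"
      unfolding F_def using that Henstock_Kurzweil_Integration.integral_combine[OF that integrable_continuous_real[OF cont]] by blast
    then show ?thesis
      using integrable_integral[OF integrable_continuous_real[OF cont[OF that(1), of b]]]
      by (metis add_diff_cancel_left')
  qed
  have T_F: "T h (F t) = F (t + h) - F h" if "h \<ge> 0" for h
  proof -
    have "((\<lambda>s. T h (T s x)) has_integral T h (F t)) {0..t}"
      using has_integral_linear[OF F[of 0 t] bounded_linear_T[OF that]] assms
      by (simp add: F_def o_def)
    moreover have "T h (T s x) = ((\<lambda>s. T s x) \<circ> (+) h) s" if "s \<in> {0..t}" for s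
      using T_add[of h s x] \<open>h \<ge> 0\<close> that by simp
    ultimately have "(((\<lambda>s. T s x) \<circ> (+) h) has_integral T h (F t)) {0..t}"
      by (rule has_integral_eq[rotated])
    then have "((\<lambda>s. T s x) has_integral T h (F t)) {0+h..t+h}"
      by (simp only: has_integral_shift_Icc_real)
    moreover have "((\<lambda>s. T s x) has_integral F (t + h) - F h) {0+h..t+h}"
      using F[of h "t + h"] that assms by simp
    ultimately show ?thesis by (rule has_integral_unique)
  qed
  have deriv: "((\<lambda>h. (F (u + h) - F u) /\<^sub>R h) \<longlongrightarrow> T u x) (at_right 0)" if "u \<ge> 0" for u
  proof -
    have "(F has_vector_derivative T u x) (at u within {0..u+1})"
      unfolding F_def using integral_has_vector_derivative[OF cont[of 0 "u+1"], of u] that by simp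
    then have ev: "\<forall>\<^sub>F y in at u within {0..u+1}. norm (F y - F u - (y - u) *\<^sub>R T u x) \<le> e * norm (y - u)"
      if "e > 0" for e
      using that by (simp add: has_vector_derivative_def has_derivative_within_alt2)
    have shift: "filterlim (\<lambda>h. u + h) (at u within {0..u+1}) (at_right 0)"
      unfolding filterlim_at
    proof
      show "((\<lambda>h. u + h) \<longlongrightarrow> u) (at_right 0)" by (auto intro!: tendsto_eq_intros)
      show "\<forall>\<^sub>F h in at_right 0. u + h \<in> {0..u+1} \<and> u + h \<noteq> u"
        using that unfolding eventually_at_right_field by (intro exI[of _ 1]) auto
    qed
    show ?thesis
    proof (rule tendstoI)
      fix e :: real assume "e > 0"
      have "\<forall>\<^sub>F h in at_right 0. norm (F (u + h) - F u - h *\<^sub>R T u x) \<le> e / 2 * norm h"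
        using eventually_compose_filterlim[OF ev[of "e/2"] shift] \<open>e > 0\<close> by simp
      with eventually_at_right_less[of 0]
      show "\<forall>\<^sub>F h in at_right 0. dist ((F (u + h) - F u) /\<^sub>R h) (T u x) < e"
      proof eventually_elim
        case (elim h)
        have "(F (u + h) - F u) /\<^sub>R h - T u x = (F (u + h) - F u - h *\<^sub>R T u x) /\<^sub>R h"
          using elim by (simp add: scaleR_diff_right)
        then have "norm ((F (u + h) - F u) /\<^sub>R h - T u x) \<le> e / 2"
          using elim by (simp add: divide_simps mult.commute)
        then show ?case using \<open>e > 0\<close> by (simp add: dist_norm)
      qed
    qed
  qed
  have F0: "F 0 = 0" by (simp add: F_def)
  have "((\<lambda>h. (F (t + h) - F t) /\<^sub>R h - (F (0 + h) - F 0) /\<^sub>R h) \<longlongrightarrow> T t x - T 0 x) (at_right 0)"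
    using assms by (intro tendsto_intros deriv) auto
  moreover have "\<forall>\<^sub>F h in at_right 0. (F (t + h) - F t) /\<^sub>R h - (F (0 + h) - F 0) /\<^sub>R h
      = (T h (F t) - F t) /\<^sub>R h"
    by (rule eventually_at_right_less[THEN eventually_mono])
      (simp add: T_F F0 algebra_simps)
  ultimately have "((\<lambda>h. (T h (F t) - F t) /\<^sub>R h) \<longlongrightarrow> T t x - x) (at_right 0)"
    using Lim_transform_eventually by fastforce
  then show "integral {0..t} (\<lambda>s. T s x) \<in> D" "A (integral {0..t} (\<lambda>s. T s x)) = T t x - x"
    unfolding F_def by (auto dest: generatorI)
qed

lemma C0_semigroup_rescaled: "C0_semigroup (rescaled l T)"
  unfolding C0_semigroup_def bounded_clinear_def
proof (intro conjI allI impI)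
  fix s t :: real and x y :: 'a and c :: complex assume t: "t \<ge> 0"
  show "bounded_linear (rescaled l T t)"
    unfolding rescaled_def
    using bounded_linear_compose[OF bounded_bilinear.bounded_linear_right[OF bounded_bilinear_scaleC]
        bounded_linear_T[OF t]] .
  show "rescaled l T t (c *\<^sub>C x) = c *\<^sub>C rescaled l T t x"
    by (simp add: rescaled_def T_scaleC[OF t] scaleC_scaleC mult.commute)
  assume s: "s \<ge> 0"
  show "rescaled l T (s + t) x = rescaled l T s (rescaled l T t x)"
    by (simp add: rescaled_def T_add[OF s t] T_scaleC[OF s] scaleC_scaleC exp_add[symmetric] algebra_simps)
next
  show "rescaled l T 0 x = x" for x by (simp add: rescaled_def)
  show "continuous_on {0..} (\<lambda>t. rescaled l T t x)" for x
    unfolding rescaled_def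
    by (intro bounded_bilinear.continuous_on[OF bounded_bilinear_scaleC] continuous_intros continuous_on_T)
qed

lemma rescaled_generator:
  assumes "x \<in> D"
  shows "x \<in> generator_domain (rescaled l T)" "generator (rescaled l T) x = A x - l *\<^sub>C x"
proof -
  interpret R: strongly_continuous_semigroup "rescaled l T" by standard (rule C0_semigroup_rescaled)
  have e0: "((\<lambda>h. exp (- l * of_real h)) \<longlongrightarrow> exp (- l * of_real 0)) (at_right (0::real))"
    by (intro tendsto_intros)
  have "((\<lambda>z. exp (- l * z)) has_field_derivative - l) (at 0)"
    by (auto intro!: derivative_eq_intros)
  then have "((\<lambda>z. (exp (- l * z) - 1) / z) \<longlongrightarrow> - l) (at 0)"
    by (simp add: has_field_derivative_iff)
  moreover have "filterlim complex_of_real (at 0) (at_right 0)"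
    unfolding filterlim_at by (auto intro!: tendsto_eq_intros simp: eventually_at_filter)
  ultimately have e1: "((\<lambda>h. (exp (- l * of_real h) - 1) / of_real h) \<longlongrightarrow> - l) (at_right (0::real))"
    by (rule filterlim_compose)
  have "((\<lambda>h. exp (- l * of_real h) *\<^sub>C ((T h x - x) /\<^sub>R h) + ((exp (- l * of_real h) - 1) / of_real h) *\<^sub>C x)
      \<longlongrightarrow> exp (- l * of_real 0) *\<^sub>C A x + (- l) *\<^sub>C x) (at_right 0)"
    by (intro tendsto_add tendsto_scaleC e0 e1 tendsto_const generator_tendsto assms)
  moreover have "exp (- l * of_real h) *\<^sub>C ((T h x - x) /\<^sub>R h) + ((exp (- l * of_real h) - 1) / of_real h) *\<^sub>C x
      = (rescaled l T h x - x) /\<^sub>R h" for h :: real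
    by (simp add: rescaled_def scaleR_scaleC scaleC_scaleC complex_vector.scale_right_diff_distrib
        complex_vector.scale_left_diff_distrib divide_inverse algebra_simps flip: of_real_inverse)
  ultimately have "((\<lambda>h. (rescaled l T h x - x) /\<^sub>R h) \<longlongrightarrow> A x - l *\<^sub>C x) (at_right 0)"
    by simp
  then show "x \<in> generator_domain (rescaled l T)" "generator (rescaled l T) x = A x - l *\<^sub>C x"
    by (auto dest: R.generatorI)
qed

lemma rescaled_domain: "generator_domain (rescaled l T) = D"
proof
  interpret R: strongly_continuous_semigroup "rescaled l T" by standard (rule C0_semigroup_rescaled)
  have "rescaled (- l) (rescaled l T) = T"
    by (intro ext) (simp add: rescaled_def scaleC_scaleC flip: exp_add)
  then show "generator_domain (rescaled l T) \<subseteq> D"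
    using R.rescaled_generator(1)[of _ "- l"] by auto
qed (use rescaled_generator in blast)

abbreviation pencil :: "complex \<Rightarrow> 'a \<Rightarrow> 'a" where
  "pencil l x \<equiv> l *\<^sub>C x - A x"

lemma pencil_diff: "x \<in> D \<Longrightarrow> y \<in> D \<Longrightarrow> pencil l (x - y) = pencil l x - pencil l y"
  by (simp add: generator_diff complex_vector.scale_right_diff_distrib)

lemma pencil_add: "x \<in> D \<Longrightarrow> y \<in> D \<Longrightarrow> pencil l (x + y) = pencil l x + pencil l y"
  by (simp add: generator_add scaleC_add_right)

lemma pencil_scale: "x \<in> D \<Longrightarrow> pencil l (c *\<^sub>C x) = c *\<^sub>C pencil l x"
  by (simp add: generator_scale scaleC_scaleC mult.commute complex_vector.scale_right_diff_distrib)

lemma norm_rescaled: "norm (rescaled l T t x) = exp (- Re l * t) * norm (T t x)"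
  by (simp add: rescaled_def norm_scaleC)

lemma rescaled_displacement_le:
  assumes "x \<in> D" "0 \<le> t" "\<And>s z. 0 \<le> s \<Longrightarrow> s \<le> t \<Longrightarrow> norm (rescaled l T s z) \<le> M * norm z"
  shows "norm (rescaled l T t x - x) \<le> t * M * norm (pencil l x)"
proof -
  interpret R: strongly_continuous_semigroup "rescaled l T" by standard (rule C0_semigroup_rescaled)
  show ?thesis
    using R.orbit_displacement_le[of x t M] assms rescaled_generator[OF assms(1), of l]
    by (simp add: norm_minus_commute)
qed

text \<open>Approximate eigenvectors move like eigenvectors, uniformly for \<open>l\<close> in a vertical strip and on compact
time intervals. This is what converts spectral information into information on orbits.\<close>

lemma orbit_near_exponential:
  assumes "\<tau> \<ge> 0"
  obtains C where "C \<ge> 0" "\<And>l x t. \<bar>Re l\<bar> \<le> L \<Longrightarrow> x \<in> D \<Longrightarrow> 0 \<le> t \<Longrightarrow> t \<le> \<tau> \<Longrightarrow>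
    norm (T t x - exp (l * of_real t) *\<^sub>C x) \<le> C * norm (pencil l x)"
proof -
  obtain M where M: "M \<ge> 1" "\<And>t x. 0 \<le> t \<Longrightarrow> t \<le> \<tau> \<Longrightarrow> norm (T t x) \<le> M * norm x"
    using T_bounded[OF assms] by blast
  define m where "m = exp (L * \<tau>)"
  have "norm (T t x - exp (l * of_real t) *\<^sub>C x) \<le> m * (\<tau> * (m * M)) * norm (pencil l x)"
    if l: "\<bar>Re l\<bar> \<le> L" and x: "x \<in> D" and t: "0 \<le> t" "t \<le> \<tau>" for l x t
  proof -
    have ex: "exp (a * s) \<le> m" if "\<bar>a\<bar> \<le> L" "0 \<le> s" "s \<le> \<tau>" for a s
      using that mult_mono[of a L s \<tau>] abs_ge_self[of a] by (simp add: m_def)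
    have b: "norm (rescaled l T s z) \<le> (m * M) * norm z" if "0 \<le> s" "s \<le> t" for s z
    proof -
      have "exp (- Re l * s) * norm (T s z) \<le> m * (M * norm z)"
        using that t l ex[of "- Re l" s] M(2)[of s z] by (intro mult_mono) (auto simp: m_def)
      then show ?thesis by (simp add: norm_rescaled mult.assoc)
    qed
    have "T t x - exp (l * of_real t) *\<^sub>C x = exp (l * of_real t) *\<^sub>C (rescaled l T t x - x)"
      by (simp add: rescaled_def scaleC_scaleC complex_vector.scale_right_diff_distrib flip: exp_add)
    then have "norm (T t x - exp (l * of_real t) *\<^sub>C x) = exp (Re l * t) * norm (rescaled l T t x - x)"
      by (simp add: norm_scaleC)
    also have "\<dots> \<le> m * (\<tau> * (m * M) * norm (pencil l x))"
    proof (rule mult_mono)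
      have "norm (rescaled l T t x - x) \<le> t * (m * M) * norm (pencil l x)"
        using rescaled_displacement_le[OF x t(1) b] .
      also have "\<dots> \<le> \<tau> * (m * M) * norm (pencil l x)"
        using t M by (intro mult_right_mono) (auto simp: m_def)
      finally show "norm (rescaled l T t x - x) \<le> \<tau> * (m * M) * norm (pencil l x)" .
    qed (use ex[OF l t] in \<open>auto simp: m_def\<close>)
    finally show ?thesis by (simp add: mult.assoc)
  qed
  moreover have "m * (\<tau> * (m * M)) \<ge> 0" using M assms by (simp add: m_def)
  ultimately show thesis using that by blast
qed

text \<open>No approximate eigenvectors for \<open>l\<close>, in quantitative form: together with surjectivity it says that \<open>l\<close>
is in the resolvent set with a resolvent of norm at most \<open>1 / \<kappa>\<close>.\<close>

definition bounded_below :: "real \<Rightarrow> complex \<Rightarrow> bool" where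
  "bounded_below \<kappa> l \<longleftrightarrow> (\<forall>x\<in>D. \<kappa> * norm x \<le> norm (pencil l x))"

definition onto :: "complex \<Rightarrow> bool" where
  "onto l \<longleftrightarrow> (\<forall>y. \<exists>x\<in>D. pencil l x = y)"

lemma bounded_below_inj:
  assumes "bounded_below \<kappa> l" "\<kappa> > 0"
  shows "inj_on (pencil l) D"
proof (rule inj_onI)
  fix x y assume xy: "x \<in> D" "y \<in> D" "pencil l x = pencil l y"
  then have "x - y \<in> D" "pencil l (x - y) = 0"
    using csubspace_D complex_vector.subspace_diff pencil_diff by (blast, simp)
  then have "\<kappa> * norm (x - y) \<le> 0" using assms(1) by (force simp: bounded_below_def)
  then show "x = y" using assms(2) by (simp add: mult_le_0_iff)
qed

lemma bounded_below_nearby: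
  assumes "bounded_below \<kappa> l" "cmod (m - l) \<le> \<delta>"
  shows "bounded_below (\<kappa> - \<delta>) m"
  unfolding bounded_below_def
proof
  fix x assume "x \<in> D"
  then have "\<kappa> * norm x \<le> norm (pencil l x)" using assms by (simp add: bounded_below_def)
  moreover have "norm (pencil l x) \<le> norm (pencil m x) + norm ((m - l) *\<^sub>C x)"
    using norm_triangle_ineq4[of "pencil m x" "(m - l) *\<^sub>C x"]
    by (simp add: complex_vector.scale_left_diff_distrib algebra_simps)
  moreover have "norm ((m - l) *\<^sub>C x) \<le> \<delta> * norm x"
    using assms(2) by (simp add: norm_scaleC mult_right_mono)
  ultimately show "(\<kappa> - \<delta>) * norm x \<le> norm (pencil m x)" by (simp add: algebra_simps)
qed

lemma resolvent_properties:
  assumes "bounded_below \<kappa> l" "\<kappa> > 0" "onto l"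
  shows "resolvent D A l y \<in> D"
    and "pencil l (resolvent D A l y) = y"
    and "norm (resolvent D A l y) \<le> norm y / \<kappa>"
    and "bounded_clinear (resolvent D A l)"
    and mem_resolvent_set: "l \<in> resolvent_set D A"
    and onorm_resolvent_le: "onorm (resolvent D A l) \<le> 1 / \<kappa>"
proof -
  let ?R = "resolvent D A l"
  have inj: "inj_on (pencil l) D" by (rule bounded_below_inj[OF assms(1,2)])
  have img: "pencil l ` D = UNIV" using assms(3) unfolding onto_def by (auto simp: image_iff) metis
  have mem: "?R y \<in> D" for y
    unfolding resolvent_def by (rule the_inv_into_into[OF inj]) (auto simp: img)
  have eq: "pencil l (?R y) = y" for y
    unfolding resolvent_def using f_the_inv_into_f[OF inj, of y] img by auto
  have uniq: "?R y = x" if "x \<in> D" "pencil l x = y" for x y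
    unfolding resolvent_def using the_inv_into_f_eq[OF inj] that by blast
  have bd: "norm (?R y) \<le> norm y / \<kappa>" for y
  proof -
    have "\<kappa> * norm (?R y) \<le> norm (pencil l (?R y))"
      using assms(1) mem unfolding bounded_below_def by blast
    then show ?thesis using assms(2) by (simp add: eq field_simps)
  qed
  have add: "?R (y + z) = ?R y + ?R z" for y z
    by (rule uniq) (simp_all add: mem eq pencil_add generator_add(1) del: generator_add(2))
  have sc: "?R (c *\<^sub>C y) = c *\<^sub>C ?R y" for c y
  proof (rule uniq)
    show "c *\<^sub>C ?R y \<in> D" by (rule generator_scale(1)[OF mem])
    show "pencil l (c *\<^sub>C ?R y) = c *\<^sub>C y" by (simp only: pencil_scale[OF mem] eq)
  qed
  have "bounded_linear ?R"
    by (rule bounded_linear_intro[of _ "1/\<kappa>"]) (use add sc bd in \<open>auto simp: scaleR_scaleC\<close>)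
  then show bc: "bounded_clinear ?R" by (simp add: bounded_clinear_def sc)
  show "?R y \<in> D" "pencil l (?R y) = y" "norm (?R y) \<le> norm y / \<kappa>" by (rule mem eq bd)+
  show "l \<in> resolvent_set D A"
    using inj img bc by (simp add: resolvent_set_def bij_betw_def)
  show "onorm ?R \<le> 1 / \<kappa>"
    using bd assms(2) by (intro onorm_bound) simp_all
qed

text \<open>The equation \<open>(m - A) x = y\<close> is equivalent to \<open>x - R ((l - m) x) = R y\<close> with the resolvent \<open>R\<close> at \<open>l\<close>,
and the operator subtracted on the left is a contraction.\<close>

lemma onto_nearby:
  assumes "bounded_below \<kappa> l" "\<kappa> > 0" "onto l" "cmod (m - l) < \<kappa>"
  shows "onto m"
  unfolding onto_def
proof
  fix y
  let ?R = "resolvent D A l"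
  note R = resolvent_properties[OF assms(1-3)]
  have lin: "bounded_linear (\<lambda>x. ?R ((l - m) *\<^sub>C x))"
    using bounded_linear_compose[of ?R, OF _ bounded_bilinear.bounded_linear_right[OF bounded_bilinear_scaleC]]
      R(4) by (simp add: bounded_clinear_def)
  have "\<exists>x. x - ?R ((l - m) *\<^sub>C x) = ?R y"
  proof (rule contraction_surj[OF lin])
    show "cmod (m - l) / \<kappa> < 1" using assms by simp
    show "norm (?R ((l - m) *\<^sub>C x)) \<le> cmod (m - l) / \<kappa> * norm x" for x
      using R(3)[of "(l - m) *\<^sub>C x"] by (simp add: norm_scaleC norm_minus_commute)
  qed
  then obtain x where x: "x - ?R ((l - m) *\<^sub>C x) = ?R y" by blast
  then have x': "x = ?R ((l - m) *\<^sub>C x) + ?R y" by (simp add: algebra_simps)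
  have "x \<in> D" by (subst x') (intro generator_add R(1))
  moreover have "pencil l x = pencil l (?R ((l - m) *\<^sub>C x) + ?R y)" by (rule arg_cong[OF x'])
  then have "pencil l x = (l - m) *\<^sub>C x + y" by (simp only: pencil_add R(1) R(2))
  then have "pencil m x = y" by (simp add: complex_vector.scale_left_diff_distrib algebra_simps)
  ultimately show "\<exists>x\<in>D. pencil m x = y" by blast
qed

text \<open>For large \<open>Re l\<close> the rescaled semigroup \<open>U\<close> satisfies \<open>norm (U 1) \<le> 1/2\<close>. The integral of the orbit of
\<open>w\<close> under \<open>U\<close> over \<open>[0,1]\<close> is mapped by \<open>l - A\<close> to \<open>w - U 1 w\<close>, and \<open>1 - U 1\<close> is invertible. This
avoids Laplace transforms.\<close>

lemma right_half_plane:
  obtains L \<kappa> where "\<kappa> > 0" "\<And>l. Re l \<ge> L \<Longrightarrow> bounded_below \<kappa> l" "\<And>l. Re l \<ge> L \<Longrightarrow> onto l"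
proof -
  obtain M where M: "M \<ge> 1" "\<And>t x. 0 \<le> t \<Longrightarrow> t \<le> 1 \<Longrightarrow> norm (T t x) \<le> M * norm x"
    using T_bounded[of 1] by auto
  define L where "L = ln (2 * M)"
  have L: "L \<ge> 0" "exp (- L) * M = 1/2" using M by (auto simp: L_def exp_minus field_simps)
  have main: "bounded_below (1 / (2 * M)) l \<and> onto l" if l: "Re l \<ge> L" for l
  proof
    interpret R: strongly_continuous_semigroup "rescaled l T" by standard (rule C0_semigroup_rescaled)
    have b: "norm (rescaled l T s z) \<le> M * norm z" if "0 \<le> s" "s \<le> 1" for s z
    proof -
      have "exp (- Re l * s) * norm (T s z) \<le> 1 * (M * norm z)"
        using that L l M(2)[of s z] by (intro mult_mono) auto
      then show ?thesis by (simp add: norm_rescaled)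
    qed
    have c: "norm (rescaled l T 1 z) \<le> 1/2 * norm z" for z
    proof -
      have "exp (- Re l * 1) * norm (T 1 z) \<le> exp (- L) * (M * norm z)"
        using l M(2)[of 1 z] by (intro mult_mono) auto
      then show ?thesis using L by (simp add: norm_rescaled flip: mult.assoc)
    qed
    show "bounded_below (1 / (2 * M)) l"
      unfolding bounded_below_def
    proof
      fix x assume "x \<in> D"
      then have "norm (rescaled l T 1 x - x) \<le> M * norm (pencil l x)"
        using rescaled_displacement_le[of x 1 l M] b by simp
      moreover have "norm x \<le> norm (rescaled l T 1 x - x) + norm (rescaled l T 1 x)"
        using norm_triangle_ineq4[of "rescaled l T 1 x" "rescaled l T 1 x - x"] by simp
      ultimately have "norm x / 2 \<le> M * norm (pencil l x)" using c[of x] by simp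
      then show "1 / (2 * M) * norm x \<le> norm (pencil l x)" using M by (simp add: field_simps)
    qed
    show "onto l"
      unfolding onto_def
    proof
      fix y
      obtain w where w: "w - rescaled l T 1 w = y"
        using contraction_surj[OF R.bounded_linear_T[of 1], of "1/2" y] c by auto
      define x where "x = integral {0..1} (\<lambda>s. rescaled l T s w)"
      have x: "x \<in> D" "generator (rescaled l T) x = rescaled l T 1 w - w"
        using R.generator_orbit_integral[of 1 w] by (simp_all add: x_def rescaled_domain)
      have "pencil l x = - generator (rescaled l T) x"
        using rescaled_generator[OF x(1), of l] by simp
      then have "pencil l x = y" using x(2) w by simp
      then show "\<exists>x\<in>D. pencil l x = y" using x(1) by blast
    qed
  qed
  show thesis
    by (rule that[of "1 / (2 * M)" L]) (use main M in auto)
qed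

text \<open>\<open>A\<close> is closed because some resolvent is a bounded operator.\<close>

lemma closed_generator:
  assumes "\<And>n. x n \<in> D" "x \<longlonglongrightarrow> l" "(\<lambda>n. pencil m (x n)) \<longlonglongrightarrow> y"
  shows "l \<in> D" "pencil m l = y"
proof -
  obtain L \<kappa> where L: "\<kappa> > 0" "bounded_below \<kappa> (of_real L)" "onto (of_real L)"
    using right_half_plane by (metis Re_complex_of_real order_refl)
  let ?R = "resolvent D A (of_real L)"
  note R = resolvent_properties[OF L(2,1,3)]
  have inj: "inj_on (pencil (of_real L)) D" by (rule bounded_below_inj[OF L(2,1)])
  define z where "z = y + (of_real L - m) *\<^sub>C l"
  have eq: "pencil (of_real L) v = pencil m v + (of_real L - m) *\<^sub>C v" for v
    by (simp add: complex_vector.scale_left_diff_distrib)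
  have "(\<lambda>n. pencil (of_real L) (x n)) \<longlonglongrightarrow> z"
    unfolding eq z_def using assms(2,3) by (intro tendsto_add tendsto_scaleC tendsto_const)
  then have "(\<lambda>n. ?R (pencil (of_real L) (x n))) \<longlonglongrightarrow> ?R z"
    using R(4) bounded_linear.tendsto unfolding bounded_clinear_def by blast
  moreover have "?R (pencil (of_real L) (x n)) = x n" for n
    using inj_onD[OF inj R(2)[of "pencil (of_real L) (x n)"] R(1) assms(1)] .
  ultimately have "x \<longlonglongrightarrow> ?R z" by simp
  then have l: "l = ?R z" using assms(2) LIMSEQ_unique by blast
  show "l \<in> D" unfolding l by (rule R(1))
  have "pencil (of_real L) l = z" unfolding l by (rule R(2))
  then show "pencil m l = y" using eq[of l] by (simp add: z_def)
qed

end

section \<open>Separated orbits and the resolvent bound\<close>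

context strongly_continuous_semigroup
begin

text \<open>The negation of this property, for a fixed \<open>b\<close>, serves as a compactness hypothesis from which the
spectral properties in the right half-plane \<open>Re l \<ge> b\<close> are derived.\<close>

definition separated :: "real \<Rightarrow> real \<Rightarrow> nat \<Rightarrow> bool" where
  "separated b c N \<longleftrightarrow> (\<exists>x. (\<forall>i. norm (x i) \<le> 1) \<and>
     (\<forall>i j n. i < j \<longrightarrow> n \<le> N \<longrightarrow> c * exp (b * real n) \<le> norm (T (real n) (x i - x (j::nat)))))"

lemma eigenvector_orbit:
  assumes "x \<in> D" "A x = l *\<^sub>C x" "t \<ge> 0"
  shows "T t x = exp (l * of_real t) *\<^sub>C x"
proof -
  obtain C where "C \<ge> 0" "norm (T t x - exp (l * of_real t) *\<^sub>C x) \<le> C * norm (pencil l x)"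
    using orbit_near_exponential[of t "\<bar>Re l\<bar>"] assms by (metis order_refl)
  then show ?thesis using assms(2) by simp
qed

text \<open>Infinitely many eigenvectors \<open>e n\<close> span an increasing sequence of spaces \<open>E n\<close>. Riesz's lemma gives unit
vectors \<open>y n\<close> in \<open>E (n + 1)\<close> at distance at least \<open>1/2\<close> from \<open>E n\<close>. Modulo \<open>E n\<close>, which is invariant, \<open>T\<close>
multiplies \<open>y n\<close> by \<open>exp (l n t)\<close>, so the orbits of the \<open>y n\<close> stay apart.\<close>

lemma finite_point_spectrum:
  assumes ns: "\<not> separated b c N" and c: "c \<le> 1/2"
  shows "finite (point_spectrum D A \<inter> {l. b \<le> Re l})"
proof (rule ccontr)
  assume "infinite (point_spectrum D A \<inter> {l. b \<le> Re l})"
  then obtain l :: "nat \<Rightarrow> complex" where l: "inj l" "range l \<subseteq> point_spectrum D A \<inter> {l. b \<le> Re l}"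
    using infinite_countable_subset by blast
  have "\<forall>n. \<exists>e. e \<in> D \<and> e \<noteq> 0 \<and> A e = l n *\<^sub>C e"
    using l(2) by (auto simp: point_spectrum_def subset_iff)
  then obtain e where e: "\<And>n. e n \<in> D" "\<And>n. e n \<noteq> 0" "\<And>n. A (e n) = l n *\<^sub>C e n" by metis
  define E where "E n = cspan (e ` {..<n})" for n
  have subE: "csubspace (E n)" for n by (simp add: E_def)
  have e_in: "e i \<in> E n" if "i < n" for i n
    using that by (auto simp: E_def intro: complex_vector.span_base)
  have E_D: "E n \<subseteq> D" for n
    unfolding E_def by (rule complex_vector.span_minimal) (use e csubspace_D in auto)
  have E_mono: "E i \<subseteq> E j" if "i \<le> j" for i j
    unfolding E_def using that by (intro complex_vector.span_mono image_mono) auto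
  have E_A: "A u \<in> E n" if "u \<in> E n" for u n
  proof -
    have "E n \<subseteq> {x \<in> D. A x \<in> E n}"
      unfolding E_def[of n]
    proof (rule complex_vector.span_minimal, fold E_def)
      show "e ` {..<n} \<subseteq> {x \<in> D. A x \<in> E n}"
        using e e_in complex_vector.subspace_scale[OF subE] by auto
      show "csubspace {x \<in> D. A x \<in> E n}"
        using subE[of n] csubspace_D
        by (auto intro!: complex_vector.subspaceI simp: generator_0 generator_add generator_scale
            complex_vector.subspace_0 complex_vector.subspace_add complex_vector.subspace_scale)
    qed
    with that show ?thesis by blast
  qed
  have E_T: "T t u \<in> E n" if "u \<in> E n" "t \<ge> 0" for u n t
  proof -
    have "E n \<subseteq> {x. T t x \<in> E n}"
      unfolding E_def[of n]
    proof (rule complex_vector.span_minimal, fold E_def)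
      show "e ` {..<n} \<subseteq> {x. T t x \<in> E n}"
        using eigenvector_orbit[OF e(1) e(3) that(2)] e_in complex_vector.subspace_scale[OF subE] by auto
      show "csubspace {x. T t x \<in> E n}"
        using subE[of n] that(2)
        by (auto intro!: complex_vector.subspaceI simp: linear_0[OF T_linear] linear_add[OF T_linear] T_scaleC
            complex_vector.subspace_0 complex_vector.subspace_add complex_vector.subspace_scale)
    qed
    with that show ?thesis by blast
  qed
  (* Eigenvectors for distinct eigenvalues are independent, in the form: E n contains no
  eigenvector for an eigenvalue different from those of its generators. *)
  have no_eigenvector: "x = 0" if "x \<in> E n" "\<forall>i<n. m \<noteq> l i" "A x = m *\<^sub>C x" for x m n
    using that
  proof (induction n arbitrary: x m)
    case 0
    then show ?case by (simp add: E_def)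
  next
    case (Suc n)
    obtain a where u: "x - a *\<^sub>C e n \<in> E n"
      using Suc.prems(1) by (auto simp: E_def lessThan_Suc complex_vector.span_insert)
    define u where "u = x - a *\<^sub>C e n"
    have x: "x = u + a *\<^sub>C e n" by (simp add: u_def)
    have uE: "u \<in> E n" "u \<in> D" using u E_D by (auto simp: u_def)
    have "A x = A u + (a * l n) *\<^sub>C e n"
      by (simp add: x generator_add generator_scale uE e scaleC_scaleC)
    then have "((m - l n) * a) *\<^sub>C e n = A u - m *\<^sub>C u"
      using Suc.prems(3) by (simp add: x algebra_simps complex_vector.scale_right_distrib
          complex_vector.scale_left_diff_distrib scaleC_scaleC)
    also have "\<dots> \<in> E n"
      using subE uE E_A by (simp add: complex_vector.subspace_diff complex_vector.subspace_scale)
    finally have in_E: "((m - l n) * a) *\<^sub>C e n \<in> E n" .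
    have "a = 0"
    proof (rule ccontr)
      assume "a \<noteq> 0"
      then have "(m - l n) * a \<noteq> 0" using Suc.prems(2) by auto
      then have "e n \<in> E n"
        using complex_vector.subspace_scale[OF subE in_E, of "1 / ((m - l n) * a)"]
        by (simp add: scaleC_scaleC)
      then have "e n = 0"
        by (rule Suc.IH[of _ "l n"]) (use e(3) l(1) in \<open>auto dest: injD\<close>)
      with e(2) show False by blast
    qed
    then have "x \<in> E n" using uE x by simp
    then show ?case using Suc.prems by (intro Suc.IH[of x m]) auto
  qed
  have "\<exists>a u. u \<in> E n \<and> norm (a *\<^sub>C e n - u) = 1 \<and> (\<forall>v\<in>E n. norm (a *\<^sub>C e n - u - v) \<ge> 1/2)" for n
  proof -
    have "e n \<notin> E n"
      using no_eigenvector[of "e n" n "l n"] e l(1) by (auto dest: injD)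
    moreover have "closed (E n)"
      using closed_span_Un_finite[of "{}" "e ` {..<n}"] by (simp add: E_def)
    ultimately show ?thesis using riesz_lemma[OF subE[of n]] by metis
  qed
  then obtain a u where u: "\<And>n. u n \<in> E n" "\<And>n. norm (a n *\<^sub>C e n - u n) = 1"
    "\<And>n v. v \<in> E n \<Longrightarrow> norm (a n *\<^sub>C e n - u n - v) \<ge> 1/2" by metis
  define y where "y n = a n *\<^sub>C e n - u n" for n
  have y_in: "y i \<in> E j" if "i < j" for i j
    using e_in[OF that] u(1)[of i] E_mono[of i j] that subE
    by (auto simp: y_def intro!: complex_vector.subspace_diff complex_vector.subspace_scale)
  have "c * exp (b * real n) \<le> norm (T (real n) (y i - y j))" if "i < j" for i j n
  proof -
    define g where "g = exp (l j * of_real (real n))"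
    define v where "v = (1/g) *\<^sub>C (T (real n) (y i) + T (real n) (u j)) - u j"
    have g: "g \<noteq> 0" "cmod g = exp (Re (l j) * real n)" by (simp_all add: g_def)
    have "v \<in> E j"
      unfolding v_def using y_in[OF that] u(1) subE
      by (intro complex_vector.subspace_diff complex_vector.subspace_scale complex_vector.subspace_add E_T) auto
    have "T (real n) (y j) = g *\<^sub>C a j *\<^sub>C e j - T (real n) (u j)"
      by (simp add: y_def T_diff T_scaleC eigenvector_orbit[OF e(1) e(3)] g_def scaleC_scaleC mult.commute)
    then have "T (real n) (y i - y j) = - (g *\<^sub>C (a j *\<^sub>C e j - u j - v))"
      using g by (simp add: T_diff v_def complex_vector.scale_right_diff_distrib scaleC_scaleC)
    then have "norm (T (real n) (y i - y j)) = cmod g * norm (a j *\<^sub>C e j - u j - v)"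
      by (simp add: norm_scaleC)
    also have "\<dots> \<ge> exp (b * real n) * (1/2)"
    proof (rule mult_mono)
      show "exp (b * real n) \<le> cmod g"
        unfolding g(2) using l(2) by (auto intro!: mult_right_mono)
    qed (use u(3)[OF \<open>v \<in> E j\<close>] in auto)
    finally show ?thesis using mult_right_mono[OF c exp_ge_zero[of "b * real n"]] by linarith
  qed
  then have "separated b c N"
    unfolding separated_def using u(2) by (intro exI[of _ y]) (auto simp: y_def)
  with ns show False ..
qed

lemma exp_ge_exp_neg:
  fixes b :: real
  assumes "n \<le> N"
  shows "exp (- \<bar>b\<bar> * real N) \<le> exp (b * real n)"
proof -
  have "\<bar>b\<bar> * real n \<le> \<bar>b\<bar> * real N" using assms by (intro mult_left_mono) auto
  moreover have "- (\<bar>b\<bar> * real n) \<le> b * real n"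
    using mult_right_mono[OF abs_ge_minus_self[of b], of "real n"] by simp
  ultimately show ?thesis by simp
qed

text \<open>A quantitative form of the statement that \<open>l - A\<close> has finite-dimensional kernel and closed range, from
which all the Fredholm properties follow. If all pairs violated the inequality, Ramsey's theorem would
give a subsequence with all mutual distances in \<open>[k \<rho>, 2 k \<rho>]\<close>. The differences with its first term,
divided by \<open>2 k \<rho>\<close>, lie in the unit ball, have mutual distance at least \<open>1/2\<close>, and are approximate
eigenvectors with an error as small as needed up to time \<open>N\<close>. Passing to differences with one fixed
term is what makes the constant of separation independent of the sequence.\<close>

lemma close_pair:
  assumes ns: "\<not> separated b c N" and c: "c \<le> 1/4" and l: "b \<le> Re l"
  obtains \<epsilon> where "\<epsilon> > 0"
    "\<And>x \<eta>. (\<And>n::nat. x n \<in> D) \<Longrightarrow> bounded (range x) \<Longrightarrow> \<eta> > 0 \<Longrightarrow>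
       \<exists>i j. i < j \<and> \<epsilon> * norm (x i - x j) \<le> max (norm (pencil l (x i - x j))) \<eta>"
proof -
  obtain C where C: "C \<ge> 0" "\<And>x t. x \<in> D \<Longrightarrow> 0 \<le> t \<Longrightarrow> t \<le> real N \<Longrightarrow>
      norm (T t x - exp (l * of_real t) *\<^sub>C x) \<le> C * norm (pencil l x)"
    using orbit_near_exponential[of "real N" "\<bar>Re l\<bar>"]
    by (metis of_nat_0_le_iff order_refl)
  define \<epsilon> where "\<epsilon> = exp (- \<bar>b\<bar> * real N) / (4 * (C + 1))"
  have \<epsilon>: "\<epsilon> > 0" using C(1) by (simp add: \<epsilon>_def)
  have C\<epsilon>: "C * \<epsilon> \<le> exp (- \<bar>b\<bar> * real N) / 4"
    using C(1) by (simp add: \<epsilon>_def field_simps)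
  have "\<exists>i j. i < j \<and> \<epsilon> * norm (x i - x j) \<le> max (norm (pencil l (x i - x j))) \<eta>"
    if x: "\<And>n::nat. x n \<in> D" and bd: "bounded (range x)" and \<eta>: "\<eta> > 0" for x \<eta>
  proof (rule ccontr)
    assume "\<not> ?thesis"
    then have far: "norm (pencil l (x i - x j)) < \<epsilon> * norm (x i - x j)" "\<eta> < \<epsilon> * norm (x i - x j)"
      if "i < j" for i j using that by (force simp: not_le)+
    define \<rho> where "\<rho> = \<eta> / \<epsilon>"
    have \<rho>: "\<rho> > 0" using \<eta> \<epsilon> by (simp add: \<rho>_def)
    obtain B where B: "\<And>n. norm (x n) \<le> B" using bd by (auto simp: bounded_iff)
    (* The colour is the distance rounded down to a multiple of \<rho>. It is never 0 since all
    distances exceed \<rho>, so within one colour distances differ by at most a factor 2. *)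
    define col where "col i j = nat \<lfloor>norm (x i - x j) / \<rho>\<rfloor>" for i j
    have "col i j \<in> {..nat \<lfloor>2 * B / \<rho>\<rfloor>}" for i j
    proof -
      have "norm (x i - x j) \<le> 2 * B"
        using norm_triangle_ineq4[of "x i" "x j"] B[of i] B[of j] by simp
      then show ?thesis
        using \<rho> by (simp add: col_def nat_mono floor_mono divide_right_mono)
    qed
    then obtain h :: "nat \<Rightarrow> nat" and k
      where h: "strict_mono h" and k: "\<And>i j. i < j \<Longrightarrow> col (h i) (h j) = k"
      using Ramsey_sequence[of "{..nat \<lfloor>2 * B / \<rho>\<rfloor>}" col] by (metis finite_atMost)
    have col_le: "real (col i j) * \<rho> \<le> norm (x i - x j)" for i j
    proof -
      have "real (col i j) = of_int \<lfloor>norm (x i - x j) / \<rho>\<rfloor>" using \<rho> by (simp add: col_def)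
      also have "\<dots> \<le> norm (x i - x j) / \<rho>" by (rule of_int_floor_le)
      finally show ?thesis using \<rho> by (simp add: field_simps)
    qed
    have col_gt: "norm (x i - x j) < (real (col i j) + 1) * \<rho>" for i j
    proof -
      have "norm (x i - x j) / \<rho> < of_int \<lfloor>norm (x i - x j) / \<rho>\<rfloor> + 1" by (rule floor_less_cancel) simp
      also have "of_int \<lfloor>norm (x i - x j) / \<rho>\<rfloor> = real (col i j)" using \<rho> by (simp add: col_def)
      finally show ?thesis using \<rho> by (simp add: field_simps)
    qed
    have "k \<ge> 1"
    proof -
      have "\<rho> < norm (x (h 0) - x (h 1))"
        using far(2)[of "h 0" "h 1"] strict_monoD[OF h, of 0 1] \<epsilon> by (simp add: \<rho>_def field_simps)
      then have "\<rho> < (real k + 1) * \<rho>" using col_gt[of "h 0" "h 1"] k[of 0 1] by simp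
      then show ?thesis using \<rho> by (cases k) auto
    qed
    define \<beta> where "\<beta> = 2 * real k * \<rho>"
    have \<beta>: "\<beta> > 0" using \<rho> \<open>k \<ge> 1\<close> by (simp add: \<beta>_def)
    have dist: "\<beta> / 2 \<le> norm (x (h i) - x (h j))" "norm (x (h i) - x (h j)) \<le> \<beta>" if "i < j" for i j
    proof -
      show "\<beta> / 2 \<le> norm (x (h i) - x (h j))"
        using col_le[of "h i" "h j"] k[OF that] by (simp add: \<beta>_def)
      have "(real k + 1) * \<rho> \<le> 2 * real k * \<rho>" using \<open>k \<ge> 1\<close> \<rho> by (intro mult_right_mono) auto
      then show "norm (x (h i) - x (h j)) \<le> \<beta>"
        using col_gt[of "h i" "h j"] k[OF that] by (simp add: \<beta>_def)
    qed
    define a where "a = complex_of_real (1 / \<beta>)"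
    have a: "cmod a = 1 / \<beta>" using \<beta> by (simp add: a_def norm_divide)
    define u where "u i = a *\<^sub>C (x (h (Suc i)) - x (h 0))" for i
    have "norm (u i) \<le> 1" for i
      using dist(2)[of 0 "Suc i"] \<beta> by (simp add: u_def norm_scaleC a norm_minus_commute)
    moreover have "c * exp (b * real n) \<le> norm (T (real n) (u i - u j))" if "i < j" "n \<le> N" for i j n
    proof -
      define w where "w = x (h (Suc i)) - x (h (Suc j))"
      have ij: "Suc i < Suc j" "h (Suc i) < h (Suc j)" using \<open>i < j\<close> h by (auto simp: strict_mono_less)
      have uij: "u i - u j = a *\<^sub>C w" by (simp add: u_def w_def flip: complex_vector.scale_right_diff_distrib)
      have w: "w \<in> D" using x csubspace_D by (simp add: w_def complex_vector.subspace_diff)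
      have "norm (u i - u j) \<ge> 1/2"
        using dist(1)[OF ij(1)] \<beta> by (simp add: uij norm_scaleC a field_simps flip: w_def)
      have "norm (pencil l (u i - u j)) = norm (pencil l w) / \<beta>"
        unfolding uij pencil_scale[OF w] norm_scaleC a by simp
      also have "\<dots> \<le> \<epsilon> * \<beta> / \<beta>"
      proof (rule divide_right_mono)
        have "norm (pencil l w) \<le> \<epsilon> * norm w" using far(1)[OF ij(2)] by (simp add: w_def)
        also have "\<dots> \<le> \<epsilon> * \<beta>" using dist(2)[OF ij(1)] \<epsilon> by (simp add: w_def)
        finally show "norm (pencil l w) \<le> \<epsilon> * \<beta>" .
      qed (use \<beta> in simp)
      finally have p: "norm (pencil l (u i - u j)) \<le> \<epsilon>" using \<beta> by simp
      have "norm (exp (l * of_real (real n)) *\<^sub>C (u i - u j))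
          \<le> norm (T (real n) (u i - u j)) + norm (T (real n) (u i - u j) - exp (l * of_real (real n)) *\<^sub>C (u i - u j))"
        by (metis norm_minus_commute norm_triangle_sub)
      also have "\<dots> \<le> norm (T (real n) (u i - u j)) + C * \<epsilon>"
        using C(2)[of "u i - u j" "real n"] \<open>n \<le> N\<close> mult_left_mono[OF p C(1)] generator_scale(1)[OF w, of a]
        unfolding uij by fastforce
      also have "\<dots> \<le> norm (T (real n) (u i - u j)) + exp (b * real n) / 4"
        using C\<epsilon> exp_ge_exp_neg[OF \<open>n \<le> N\<close>, of b] by linarith
      finally have "exp (Re l * real n) * norm (u i - u j) \<le> norm (T (real n) (u i - u j)) + exp (b * real n) / 4"
        by (simp add: norm_scaleC)
      moreover have "exp (b * real n) * (1/2) \<le> exp (Re l * real n) * norm (u i - u j)"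
        using l \<open>norm (u i - u j) \<ge> 1/2\<close> by (intro mult_mono) (auto intro: mult_right_mono)
      moreover have "c * exp (b * real n) \<le> 1/4 * exp (b * real n)"
        using c by (intro mult_right_mono) auto
      ultimately show ?thesis by linarith
    qed
    ultimately have "separated b c N" unfolding separated_def by blast
    with ns show False ..
  qed
  with \<epsilon> show thesis using that by blast
qed

lemma convergent_preimages:
  assumes ns: "\<not> separated b c N" "c \<le> 1/4" and l: "b \<le> Re l"
    and x: "\<And>n. x n \<in> D" and bd: "bounded (range x)" and y: "(\<lambda>n. pencil l (x n)) \<longlonglongrightarrow> y"
  obtains h v where "strict_mono h" "(x \<circ> h) \<longlonglongrightarrow> v" "v \<in> D" "pencil l v = y"
proof -
  obtain \<epsilon> where \<epsilon>: "\<epsilon> > 0" "\<And>x \<eta>. (\<And>n::nat. x n \<in> D) \<Longrightarrow> bounded (range x) \<Longrightarrow> \<eta> > 0 \<Longrightarrow>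
       \<exists>i j. i < j \<and> \<epsilon> * norm (x i - x j) \<le> max (norm (pencil l (x i - x j))) \<eta>"
    using close_pair[OF ns l] by metis
  have "\<exists>i j. i < j \<and> dist (x (h i)) (x (h j)) < e" if e: "e > 0" and h: "strict_mono h"
    for e :: real and h :: "nat \<Rightarrow> nat"
  proof -
    obtain m where m: "\<And>i j. i \<ge> m \<Longrightarrow> j \<ge> m \<Longrightarrow> norm (pencil l (x i) - pencil l (x j)) < \<epsilon> * (e / 2)"
      using LIMSEQ_imp_Cauchy[OF y] e \<epsilon>(1) unfolding Cauchy_iff by (metis half_gt_zero mult_pos_pos)
    have "bounded (range (\<lambda>i. x (h (i + m))))"
      using bd by (rule bounded_subset) auto
    then obtain i j where ij: "i < j"
      "\<epsilon> * norm (x (h (i + m)) - x (h (j + m))) \<le>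
        max (norm (pencil l (x (h (i + m)) - x (h (j + m))))) (\<epsilon> * (e / 2))"
      using \<epsilon>(2)[of "\<lambda>i. x (h (i + m))" "\<epsilon> * (e / 2)"] x e \<epsilon>(1) by auto
    have ge: "h (i + m) \<ge> m" for i using strict_mono_imp_increasing[OF h, of "i + m"] by linarith
    have "norm (pencil l (x (h (i + m)) - x (h (j + m)))) < \<epsilon> * (e / 2)"
      unfolding pencil_diff[OF x x] by (rule m[OF ge ge])
    then have "\<epsilon> * norm (x (h (i + m)) - x (h (j + m))) \<le> \<epsilon> * (e / 2)" using ij(2) by linarith
    then have "norm (x (h (i + m)) - x (h (j + m))) < e" using \<epsilon>(1) e by simp
    then show ?thesis using ij(1) by (intro exI[of _ "i + m"] exI[of _ "j + m"]) (simp add: dist_norm)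
  qed
  then obtain h :: "nat \<Rightarrow> nat" and v where h: "strict_mono h" "(x \<circ> h) \<longlonglongrightarrow> v"
    using convergent_subsequence[of x] by blast
  have "(\<lambda>n. pencil l ((x \<circ> h) n)) \<longlonglongrightarrow> y"
    using LIMSEQ_subseq_LIMSEQ[OF y h(1)] by (simp add: o_def)
  then have "v \<in> D" "pencil l v = y"
    using closed_generator[of "x \<circ> h" v l y] x h(2) by auto
  with h show thesis by (rule that)
qed

abbreviation kernel :: "complex \<Rightarrow> 'a set" where
  "kernel l \<equiv> {x \<in> D. pencil l x = 0}"

lemma csubspace_kernel: "csubspace (kernel l)"
proof (rule complex_vector.subspaceI)
  show "0 \<in> kernel l" using generator_0 by simp
  show "x + y \<in> kernel l" if "x \<in> kernel l" "y \<in> kernel l" for x y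
    using that pencil_add[of x y l] generator_add(1)[of x y] by simp
  show "c *\<^sub>C x \<in> kernel l" if "x \<in> kernel l" for c x
    using that pencil_scale[of x l c] generator_scale(1)[of x c] by simp
qed

lemma closed_kernel: "closed (kernel l)"
  unfolding closed_sequential_limits
proof (intro allI impI)
  fix x v assume "(\<forall>n. x n \<in> kernel l) \<and> x \<longlonglongrightarrow> v"
  then show "v \<in> kernel l"
    using closed_generator[of x v l 0] by (simp add: tendsto_const)
qed

text \<open>Otherwise Riesz's lemma gives unit vectors \<open>v k\<close> at distance at least \<open>1/2\<close> from the kernel with
\<open>pencil l (v k)\<close> tending to zero. A subsequence converges, and its limit is in the kernel.\<close>

lemma bounded_below_mod_kernel:
  assumes ns: "\<not> separated b c N" "c \<le> 1/4" and l: "b \<le> Re l"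
  obtains C where "C > 0" "\<And>x. x \<in> D \<Longrightarrow> \<exists>g\<in>kernel l. norm (x - g) \<le> C * norm (pencil l x)"
proof (rule ccontr)
  assume "\<not> thesis"
  then have ex: "\<forall>k. \<exists>x. x \<in> D \<and> (\<forall>g\<in>kernel l. norm (x - g) > real (Suc k) * norm (pencil l x))"
    using that[of "real (Suc k)" for k] by (meson not_le of_nat_0_less_iff zero_less_Suc)
  obtain x where x: "\<And>k. x k \<in> D"
    "\<And>k g. g \<in> kernel l \<Longrightarrow> norm (x k - g) > real (Suc k) * norm (pencil l (x k))"
    using choice[OF ex] by blast
  have ex: "\<forall>k. \<exists>v. v \<in> D \<and> norm v = 1 \<and> norm (pencil l v) \<le> 1 / real (Suc k) \<and>
      (\<forall>g\<in>kernel l. norm (v - g) \<ge> 1/2)"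
  proof
    fix k
    have "x k \<notin> kernel l" using x(2)[of "x k" k] by auto
    then obtain a u where au: "a \<noteq> 0" "u \<in> kernel l" "norm (a *\<^sub>C x k - u) = 1"
      "\<And>g. g \<in> kernel l \<Longrightarrow> norm (a *\<^sub>C x k - u - g) \<ge> 1/2"
      by (rule riesz_lemma[OF csubspace_kernel closed_kernel]) blast
    define v where "v = a *\<^sub>C x k - u"
    have u: "u \<in> D" "pencil l u = 0" using au(2) by auto
    have vD: "v \<in> D"
      unfolding v_def by (rule complex_vector.subspace_diff[OF csubspace_D generator_scale(1)[OF x(1)] u(1)])
    have "pencil l v = a *\<^sub>C pencil l (x k)"
      unfolding v_def pencil_diff[OF generator_scale(1)[OF x(1)] u(1)] pencil_scale[OF x(1)] u(2) by simp
    then have "real (Suc k) * norm (pencil l v) = cmod a * (real (Suc k) * norm (pencil l (x k)))"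
      by (simp add: norm_scaleC)
    also have "\<dots> \<le> cmod a * norm (x k - (1 / a) *\<^sub>C u)"
      using x(2)[OF complex_vector.subspace_scale[OF csubspace_kernel au(2)], of k "1 / a"]
      by (intro mult_left_mono) auto
    also have "\<dots> = norm v"
      using au(1) unfolding v_def norm_scaleC[symmetric]
      by (simp add: complex_vector.scale_right_diff_distrib scaleC_scaleC)
    also have "\<dots> = 1" using au(3) by (simp add: v_def)
    finally have "norm (pencil l v) \<le> 1 / real (Suc k)" by (simp add: field_simps)
    moreover have "norm v = 1" "\<forall>g\<in>kernel l. norm (v - g) \<ge> 1/2" using au(3,4) unfolding v_def by blast+
    ultimately show "\<exists>v. v \<in> D \<and> norm v = 1 \<and> norm (pencil l v) \<le> 1 / real (Suc k) \<and>
      (\<forall>g\<in>kernel l. norm (v - g) \<ge> 1/2)" using vD by blast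
  qed
  obtain v where v: "\<And>k. v k \<in> D" "\<And>k. norm (v k) = 1"
    "\<And>k. norm (pencil l (v k)) \<le> 1 / real (Suc k)"
    "\<And>k g. g \<in> kernel l \<Longrightarrow> norm (v k - g) \<ge> 1/2"
    using choice[OF ex] by blast
  have "(\<lambda>k. pencil l (v k)) \<longlonglongrightarrow> 0"
  proof (rule Lim_null_comparison)
    show "(\<lambda>k. 1 / real (Suc k)) \<longlonglongrightarrow> 0" using LIMSEQ_Suc[OF lim_const_over_n[of 1]] by simp
  qed (use v(3) in auto)
  moreover have "bounded (range v)" using v(2) by (auto simp: bounded_iff intro!: exI[of _ 1])
  ultimately obtain h w where "(v \<circ> h) \<longlonglongrightarrow> w" "w \<in> D" "pencil l w = 0"
    using convergent_preimages[where x=v and y=0, OF ns l v(1)] by blast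
  then have h: "(v \<circ> h) \<longlonglongrightarrow> w" "w \<in> kernel l" by auto
  have "(\<lambda>k. norm ((v \<circ> h) k - w)) \<longlonglongrightarrow> norm (w - w)"
    using h(1) by (intro tendsto_intros)
  then have "1/2 \<le> norm (w - w)"
    by (rule LIMSEQ_le_const) (use v(4)[OF h(2)] in auto)
  then show False by simp
qed

lemma finite_dimensional_kernel:
  assumes ns: "\<not> separated b c N" "c \<le> 1/4" and l: "b \<le> Re l"
  shows "finite_dimensional (kernel l)"
proof (rule ccontr)
  assume nf: "\<not> ?thesis"
  have inf: "\<not> kernel l \<subseteq> cspan ({} \<union> F)" if "finite F" for F
    using nf that unfolding finite_dimensional_def Un_empty_left by blast
  have cl: "closed (cspan ({}::'a set))" by simp
  obtain z :: "nat \<Rightarrow> 'a" where z: "\<And>n. z n \<in> kernel l" "\<And>n. norm (z n) = 1"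
    "\<And>i j v. i < j \<Longrightarrow> v \<in> cspan {} \<Longrightarrow> norm (z j - z i - v) \<ge> 1/2"
    using riesz_sequence[OF csubspace_kernel empty_subsetI cl inf] by blast
  obtain \<epsilon> where \<epsilon>: "\<epsilon> > 0" "\<And>x \<eta>. (\<And>n::nat. x n \<in> D) \<Longrightarrow> bounded (range x) \<Longrightarrow> \<eta> > 0 \<Longrightarrow>
       \<exists>i j. i < j \<and> \<epsilon> * norm (x i - x j) \<le> max (norm (pencil l (x i - x j))) \<eta>"
    using close_pair[OF ns l] by metis
  have zD: "z n \<in> D" "pencil l (z n) = 0" for n using z(1)[of n] by auto
  have "bounded (range z)" using z(2) by (auto simp: bounded_iff intro!: exI[of _ 1])
  then obtain i j where ij: "i < j" "\<epsilon> * norm (z i - z j) \<le> max (norm (pencil l (z i - z j))) (\<epsilon> / 4)"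
    using \<epsilon>(2)[of z "\<epsilon> / 4"] \<epsilon>(1) zD by auto
  have "pencil l (z i - z j) = 0" unfolding pencil_diff[OF zD(1) zD(1)] zD(2) by simp
  then have "\<epsilon> * norm (z i - z j) \<le> \<epsilon> * (1/4)" using ij(2) \<epsilon>(1) by simp
  then have "norm (z i - z j) \<le> 1/4" using \<epsilon>(1) by simp
  moreover have "norm (z i - z j) \<ge> 1/2" using z(3)[OF ij(1), of 0] by (simp add: norm_minus_commute)
  ultimately show False by simp
qed

lemma closed_range:
  assumes ns: "\<not> separated b c N" "c \<le> 1/4" and l: "b \<le> Re l"
  shows "closed (pencil l ` D)"
  unfolding closed_sequential_limits
proof (intro allI impI)
  fix y v assume y: "(\<forall>n. y n \<in> pencil l ` D) \<and> y \<longlonglongrightarrow> v"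
  then have "\<forall>n. \<exists>x. x \<in> D \<and> y n = pencil l x" by blast
  from choice[OF this] obtain x where x: "\<And>n. x n \<in> D" "\<And>n. y n = pencil l (x n)" by blast
  obtain C where C: "C > 0" "\<And>x. x \<in> D \<Longrightarrow> \<exists>g\<in>kernel l. norm (x - g) \<le> C * norm (pencil l x)"
    using bounded_below_mod_kernel[OF ns l] by blast
  have "\<forall>n. \<exists>g. g \<in> kernel l \<and> norm (x n - g) \<le> C * norm (y n)"
    unfolding x(2) using C(2)[OF x(1)] by blast
  from choice[OF this] obtain g
    where g: "\<And>n. g n \<in> kernel l" "\<And>n. norm (x n - g n) \<le> C * norm (y n)" by blast
  have p: "pencil l (x n - g n) = y n" for n
    using pencil_diff[of "x n" "g n" l] x[of n] g(1)[of n] by simp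
  have d: "x n - g n \<in> D" for n
    using x g(1)[of n] csubspace_D by (simp add: complex_vector.subspace_diff)
  have "bounded (range y)" using y convergent_imp_bounded by blast
  then obtain B where "\<And>n. norm (y n) \<le> B" unfolding bounded_iff by blast
  then have "norm (x n - g n) \<le> C * B" for n
    using g(2)[of n] mult_left_mono[of "norm (y n)" B C] C(1) by (meson less_imp_le order_trans)
  then have bd: "bounded (range (\<lambda>n. x n - g n))" unfolding bounded_iff by blast
  have "(\<lambda>n. pencil l (x n - g n)) \<longlonglongrightarrow> v" unfolding p using y by simp
  then obtain w where "w \<in> D" "pencil l w = v"
    using convergent_preimages[where x="\<lambda>n. x n - g n" and y=v, OF ns l d bd] by blast
  then show "v \<in> pencil l ` D" by blast
qed

lemma bounded_below_off_spectrum: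
  assumes ns: "\<not> separated b c N" "c \<le> 1/4" and l: "b \<le> Re l" "l \<notin> point_spectrum D A"
  obtains \<kappa> where "\<kappa> > 0" "bounded_below \<kappa> l"
proof -
  obtain C where C: "C > 0" "\<And>x. x \<in> D \<Longrightarrow> \<exists>g\<in>kernel l. norm (x - g) \<le> C * norm (pencil l x)"
    using bounded_below_mod_kernel[OF ns l(1)] by blast
  have k0: "g = 0" if "g \<in> kernel l" for g
    using l(2) that by (auto simp: point_spectrum_def)
  have "norm x \<le> C * norm (pencil l x)" if "x \<in> D" for x
    using C(2)[OF that] k0 by fastforce
  then have "bounded_below (1 / C) l" using C(1) by (simp add: bounded_below_def field_simps)
  then show thesis using that[of "1 / C"] C(1) by simp
qed

text \<open>The half-plane remains connected when the finitely many eigenvalues are removed. On what is left, both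
surjectivity and its failure are open conditions, since \<open>l - A\<close> is bounded below locally uniformly;
surjectivity holds far to the right.\<close>

lemma onto_off_spectrum:
  assumes ns: "\<not> separated b c N" "c \<le> 1/4" and l: "b \<le> Re l" "l \<notin> point_spectrum D A"
  shows "onto l"
proof -
  define H where "H = {l. b \<le> Re l} - (point_spectrum D A \<inter> {l. b \<le> Re l})"
  have bb: "\<exists>\<kappa>>0. bounded_below \<kappa> m" if "m \<in> H" for m
    using bounded_below_off_spectrum[OF ns, of m] that by (auto simp: H_def)
  have fin: "finite (point_spectrum D A \<inter> {l. b \<le> Re l})"
    using finite_point_spectrum[OF ns(1)] ns(2) by simp
  have "connected H"
    unfolding H_def
  proof (rule connected_convex_diff_countable)
    show "convex {l. b \<le> Re l}" by (rule convex_halfspace_Re_ge)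
    show "\<not> collinear {l. b \<le> Re l}"
    proof
      assume "collinear {l. b \<le> Re l}"
      then have "collinear {Complex b 0, Complex (b + 1) 0, Complex b 1}"
        by (rule collinear_subset) auto
      then show False
        by (auto simp: collinear_3_expand complex_eq_iff)
    qed
  qed (use fin in \<open>simp add: countable_finite\<close>)
  moreover define S where "S = {m \<in> H. onto m}"
  have "openin (top_of_set H) S"
    unfolding openin_euclidean_subtopology_iff
  proof (intro conjI ballI)
    fix m assume m: "m \<in> S"
    obtain \<kappa> where "\<kappa> > 0" "bounded_below \<kappa> m" using bb m by (auto simp: S_def)
    then show "\<exists>e>0. \<forall>m'\<in>H. dist m' m < e \<longrightarrow> m' \<in> S"
      using onto_nearby[of \<kappa> m] m by (intro exI[of _ \<kappa>]) (auto simp: S_def dist_norm)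
  qed (auto simp: S_def)
  moreover have "openin (top_of_set H) (H - S)"
    unfolding openin_euclidean_subtopology_iff
  proof (intro conjI ballI)
    fix m assume m: "m \<in> H - S"
    obtain \<kappa> where \<kappa>: "\<kappa> > 0" "bounded_below \<kappa> m" using bb m by auto
    have "m' \<in> H - S" if m': "m' \<in> H" "dist m' m < \<kappa> / 2" for m'
    proof -
      have "bounded_below (\<kappa> - \<kappa> / 2) m'"
        using bounded_below_nearby[OF \<kappa>(2), of m' "\<kappa> / 2"] m'(2) by (simp add: dist_norm)
      then have "\<not> onto m'"
        using onto_nearby[of "\<kappa> / 2" m' m] \<kappa>(1) m m'(2) by (auto simp: S_def dist_norm norm_minus_commute)
      then show ?thesis using m' by (simp add: S_def)
    qed
    then show "\<exists>e>0. \<forall>m'\<in>H. dist m' m < e \<longrightarrow> m' \<in> H - S"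
      using \<kappa>(1) by (intro exI[of _ "\<kappa> / 2"]) auto
  qed auto
  then have "closedin (top_of_set H) S" by (auto simp: closedin_def S_def)
  moreover have "S \<noteq> {}"
  proof -
    obtain \<kappa> L where L: "\<kappa> > 0" "\<And>l. Re l \<ge> L \<Longrightarrow> bounded_below \<kappa> l" "\<And>l. Re l \<ge> L \<Longrightarrow> onto l"
      by (rule right_half_plane) blast
    define m where "m = complex_of_real (max b L)"
    have m: "bounded_below \<kappa> m" "onto m" using L by (auto simp: m_def)
    have "m \<notin> point_spectrum D A"
    proof
      assume "m \<in> point_spectrum D A"
      then obtain x where "x \<in> D" "x \<noteq> 0" "A x = m *\<^sub>C x" by (auto simp: point_spectrum_def)
      then show False using m(1) L(1) by (auto simp: bounded_below_def mult_le_0_iff)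
    qed
    then have "m \<in> S" using m by (simp add: S_def H_def m_def)
    then show ?thesis by blast
  qed
  ultimately have "S = H" unfolding connected_clopen by blast
  then show ?thesis using l by (auto simp: S_def H_def)
qed

lemma csubspace_range: "csubspace (pencil l ` D)"
proof (rule complex_vector.subspaceI)
  show "0 \<in> pencil l ` D" using generator_0 by (auto intro!: image_eqI[of _ _ 0])
next
  fix y z assume "y \<in> pencil l ` D" "z \<in> pencil l ` D"
  then obtain u v where uv: "u \<in> D" "v \<in> D" "y = pencil l u" "z = pencil l v" by blast
  have "y + z = pencil l (u + v)" unfolding uv(3,4) by (rule pencil_add[OF uv(1,2), symmetric])
  then show "y + z \<in> pencil l ` D" by (rule image_eqI) (rule generator_add(1)[OF uv(1,2)])
next
  fix c y assume "y \<in> pencil l ` D"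
  then obtain u where u: "u \<in> D" "y = pencil l u" by blast
  have "c *\<^sub>C y = pencil l (c *\<^sub>C u)" unfolding u(2) by (rule pencil_scale[OF u(1), symmetric])
  then show "c *\<^sub>C y \<in> pencil l ` D" by (rule image_eqI) (rule generator_scale(1)[OF u(1)])
qed

text \<open>At an eigenvalue, compare with a nearby non-eigenvalue \<open>m = l + \<delta>\<close>, where the resolvent exists. If the
range had infinite codimension, take a Riesz sequence \<open>z n\<close> modulo the range and set \<open>x n = R z n\<close> with
the resolvent \<open>R\<close> at \<open>m\<close>. By \<open>close_pair\<close>, some difference \<open>w\<close> of the \<open>x n\<close> has a norm bounded independently
of \<open>\<delta>\<close>, so the corresponding difference of the \<open>z n\<close> is within \<open>\<delta> norm w\<close> of the range: too close.\<close>

lemma finite_codimensional_range: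
  assumes ns: "\<not> separated b c N" "c \<le> 1/4" and l: "b \<le> Re l"
  shows "finite_codimensional (pencil l ` D)"
proof (rule ccontr)
  let ?Y = "pencil l ` D"
  assume nf: "\<not> ?thesis"
  have spanY: "cspan ?Y = ?Y" by (rule complex_vector.span_eq_iff[THEN iffD2, OF csubspace_range])
  have inf: "\<not> UNIV \<subseteq> cspan (?Y \<union> F)" if "finite F" for F
    using nf that by (auto simp: finite_codimensional_def)
  have cl: "closed (cspan ?Y)" unfolding spanY by (rule closed_range[OF ns l])
  obtain z :: "nat \<Rightarrow> 'a" where z: "\<And>n. norm (z n) = 1" "\<And>i j v. i < j \<Longrightarrow> v \<in> ?Y \<Longrightarrow> norm (z j - z i - v) \<ge> 1/2"
  proof (rule riesz_sequence[OF complex_vector.subspace_UNIV subset_UNIV cl inf, unfolded spanY])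
    fix z :: "nat \<Rightarrow> 'a"
    assume "\<And>n. norm (z n) = 1"
      "\<And>i j v. i < j \<Longrightarrow> v \<in> ?Y \<Longrightarrow> norm (z j - z i - v) \<ge> 1/2"
    then show thesis by (rule that)
  qed
  obtain \<epsilon> where \<epsilon>: "\<epsilon> > 0" "\<And>x \<eta>. (\<And>n::nat. x n \<in> D) \<Longrightarrow> bounded (range x) \<Longrightarrow> \<eta> > 0 \<Longrightarrow>
       \<exists>i j. i < j \<and> \<epsilon> * norm (x i - x j) \<le> max (norm (pencil l (x i - x j))) \<eta>"
    by (rule close_pair[OF ns l]) blast
  obtain \<delta> where \<delta>: "0 < \<delta>" "\<delta> \<le> \<epsilon> / 16" "l + of_real \<delta> \<notin> point_spectrum D A"
  proof -
    have "infinite ((\<lambda>\<delta>. l + complex_of_real \<delta>) ` {0<..\<epsilon> / 16})"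
      using \<epsilon>(1) by (subst finite_image_iff) (auto simp: inj_on_def infinite_Ioc)
    moreover have "finite (point_spectrum D A \<inter> {l. b \<le> Re l})"
      using finite_point_spectrum[OF ns(1)] ns(2) by simp
    ultimately have "\<not> (\<lambda>\<delta>. l + complex_of_real \<delta>) ` {0<..\<epsilon> / 16} \<subseteq> point_spectrum D A \<inter> {l. b \<le> Re l}"
      by (meson finite_subset)
    then show thesis using that l by (auto simp: subset_iff)
  qed
  define m where "m = l + of_real \<delta>"
  have m: "b \<le> Re m" "m \<notin> point_spectrum D A" using \<delta> l by (auto simp: m_def)
  obtain \<kappa> where \<kappa>: "\<kappa> > 0" "bounded_below \<kappa> m" using bounded_below_off_spectrum[OF ns m] by blast
  note R = resolvent_properties[OF \<kappa>(2,1) onto_off_spectrum[OF ns m]]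
  define x where "x n = resolvent D A m (z n)" for n
  have x: "x n \<in> D" "pencil m (x n) = z n" for n unfolding x_def by (rule R)+
  have "norm (x n) \<le> 1 / \<kappa>" for n using R(3)[of "z n"] z(1) by (simp add: x_def)
  then have "bounded (range x)" by (auto simp: bounded_iff)
  then obtain i j where ij: "i < j" "\<epsilon> * norm (x i - x j) \<le> max (norm (pencil l (x i - x j))) 1"
    using \<epsilon>(2)[of x 1] x(1) by auto
  define w where "w = x i - x j"
  have w: "w \<in> D" using x csubspace_D by (simp add: w_def complex_vector.subspace_diff)
  have "pencil m w = z i - z j" unfolding w_def pencil_diff[OF x(1) x(1)] x(2) ..
  then have pw: "pencil l w = z i - z j - of_real \<delta> *\<^sub>C w"
    by (simp add: m_def scaleC_add_left algebra_simps)
  have nd: "norm (of_real \<delta> *\<^sub>C w) = \<delta> * norm w" using \<delta> by (simp add: norm_scaleC)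
  have "norm (pencil l w) \<le> 2 + \<delta> * norm w"
    unfolding pw using norm_triangle_ineq4[of "z i - z j" "of_real \<delta> *\<^sub>C w"]
      norm_triangle_ineq4[of "z i" "z j"] z(1)[of i] z(1)[of j] nd by linarith
  moreover have "\<delta> * norm w \<ge> 0" using \<delta> by simp
  ultimately have "\<epsilon> * norm w \<le> 2 + \<delta> * norm w" using ij(2) unfolding w_def by linarith
  moreover have "\<delta> * norm w \<le> \<epsilon> / 16 * norm w" using \<delta> by (intro mult_right_mono) auto
  ultimately have small: "\<delta> * norm w < 1/2" by linarith
  have "- pencil l w \<in> ?Y"
    using complex_vector.subspace_neg[OF csubspace_range[of l]] w by blast
  from z(2)[OF ij(1) this] have "1/2 \<le> norm (z j - z i + pencil l w)"
    by (simp only: diff_minus_eq_add)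
  also have "z j - z i + pencil l w = - (of_real \<delta> *\<^sub>C w)" by (simp add: pw)
  finally show False using small nd by simp
qed

lemma fredholm_pencil:
  assumes ns: "\<not> separated b c N" "c \<le> 1/4" and l: "b \<le> Re l"
  shows "fredholm D (pencil l)"
  unfolding fredholm_def
  using finite_dimensional_kernel[OF assms] closed_range[OF assms] finite_codimensional_range[OF assms]
  by blast

text \<open>Let \<open>x k\<close> be unit approximate eigenvectors for \<open>\<beta> + \<i> s k\<close> with \<open>\<bar>s k\<bar>\<close> unbounded. At the short time
\<open>t k = pi / \<bar>s k\<bar>\<close> the semigroup nearly reverses \<open>x k\<close>, whereas it hardly moves any fixed earlier vector.
So \<open>x i\<close> and \<open>x k\<close> cannot be close, and the same holds for their images under \<open>T n\<close>.\<close>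

lemma bounded_below_vertical_line:
  assumes ns: "\<not> separated b c N" and c: "c \<le> 1 / (M + 1)"
    and M: "M \<ge> 1" "\<And>t x. 0 \<le> t \<Longrightarrow> t \<le> 1 \<Longrightarrow> norm (T t x) \<le> M * norm x" and \<beta>: "b \<le> \<beta>"
  obtains R \<kappa> where "\<kappa> > 0" "\<And>s. R \<le> \<bar>s\<bar> \<Longrightarrow> bounded_below \<kappa> (Complex \<beta> s)"
proof (rule ccontr)
  assume "\<not> thesis"
  then have "\<exists>s. real (k + 4) \<le> \<bar>s\<bar> \<and> \<not> bounded_below (1 / real (Suc k)) (Complex \<beta> s)" for k
    using that[of "1 / real (Suc k)" "real (k + 4)"] by (metis of_nat_0_less_iff zero_less_Suc zero_less_divide_1_iff)
  then obtain s where s: "\<And>k. real (k + 4) \<le> \<bar>s k\<bar>"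
    "\<And>k. \<not> bounded_below (1 / real (Suc k)) (Complex \<beta> (s k))" by metis
  define l where "l k = Complex \<beta> (s k)" for k
  have "\<exists>x\<in>D. norm x = 1 \<and> norm (pencil (l k) x) \<le> 1 / real (Suc k)" for k
  proof -
    obtain y where y: "y \<in> D" "norm (pencil (l k) y) < 1 / real (Suc k) * norm y"
      using s(2)[of k] by (auto simp: bounded_below_def l_def not_le)
    then have ny: "norm y > 0" by (cases "y = 0") (auto simp: generator_0)
    define x where "x = of_real (1 / norm y) *\<^sub>C y"
    have "x \<in> D" "norm x = 1" using y ny generator_scale(1) by (auto simp: x_def norm_scaleC norm_divide)
    moreover have "norm (pencil (l k) x) \<le> 1 / real (Suc k)"
      unfolding x_def pencil_scale[OF y(1)] norm_scaleC
      using y(2) ny by (simp add: norm_divide field_simps)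
    ultimately show ?thesis by blast
  qed
  then obtain x where x: "\<And>k. x k \<in> D" "\<And>k. norm (x k) = 1"
    "\<And>k. norm (pencil (l k) (x k)) \<le> 1 / real (Suc k)" by metis
  obtain C where C: "C \<ge> 0" "\<And>k t. 0 \<le> t \<Longrightarrow> t \<le> real N + 1 \<Longrightarrow>
      norm (T t (x k) - exp (l k * of_real t) *\<^sub>C x k) \<le> C / real (Suc k)"
  proof -
    obtain C where C: "C \<ge> 0" "\<And>l x t. \<bar>Re l\<bar> \<le> \<bar>\<beta>\<bar> \<Longrightarrow> x \<in> D \<Longrightarrow> 0 \<le> t \<Longrightarrow> t \<le> real N + 1 \<Longrightarrow>
        norm (T t x - exp (l * of_real t) *\<^sub>C x) \<le> C * norm (pencil l x)"
      using orbit_near_exponential[of "real N + 1" "\<bar>\<beta>\<bar>"] by auto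
    have "norm (T t (x k) - exp (l k * of_real t) *\<^sub>C x k) \<le> C / real (Suc k)"
      if "0 \<le> t" "t \<le> real N + 1" for k t
      using C(2)[of "l k" "x k" t] x(1) that mult_left_mono[OF x(3)[of k] C(1)]
      by (simp add: l_def)
    with C(1) show thesis by (rule that)
  qed
  obtain K where K: "K \<ge> 1" "\<And>t x. 0 \<le> t \<Longrightarrow> t \<le> real N \<Longrightarrow> norm (T t x) \<le> K * norm x"
    using T_bounded[of "real N"] by auto
  have over: "(\<lambda>k. C / real (Suc k)) \<longlonglongrightarrow> 0" using LIMSEQ_Suc[OF lim_const_over_n[of C]] by simp
  define t where "t k = pi / \<bar>s k\<bar>" for k
  have t: "0 \<le> t k" "t k \<le> 1" for k
  proof -
    have "pi \<le> \<bar>s k\<bar>" using s(1)[of k] pi_less_4 by simp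
    then show "0 \<le> t k" "t k \<le> 1" by (auto simp: t_def divide_le_eq_1)
  qed
  have t0: "t \<longlonglongrightarrow> 0"
  proof (rule real_tendsto_sandwich[where f="\<lambda>_. 0" and h="\<lambda>k. pi / real (Suc k)"])
    show "(\<lambda>k. pi / real (Suc k)) \<longlonglongrightarrow> 0" using LIMSEQ_Suc[OF lim_const_over_n[of pi]] by simp
    have "t k \<le> pi / real (Suc k)" for k
      unfolding t_def using s(1)[of k] by (intro divide_left_mono) auto
    then show "\<forall>\<^sub>F k in sequentially. t k \<le> pi / real (Suc k)" by simp
  qed (use t in auto)
  (* The time t k is half the period of the rotation exp (i s k t). *)
  have flip: "exp (l k * of_real (t k)) = - of_real (exp (\<beta> * t k))" for k
  proof -
    have "s k \<noteq> 0" using s(1)[of k] by auto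
    then have "s k * t k = pi \<or> s k * t k = - pi" by (auto simp: t_def abs_if)
    then have "cis (s k * t k) = - 1" by (auto simp: complex_eq_iff)
    moreover have "l k * of_real (t k) = Complex (\<beta> * t k) (s k * t k)"
      by (simp add: l_def complex_eq_iff)
    ultimately show ?thesis by (simp add: exp_eq_polar exp_of_real)
  qed
  define err where "err i n j = norm (T (t j) (T (real n) (x i)) - T (real n) (x i)) +
    norm (T (t j) (T (real n) (x j)) + T (real n) (x j))" for i n j
  have err: "err i n \<longlonglongrightarrow> 0" if n: "n \<le> N" for i n
  proof -
    have "(\<lambda>j. T (t j) (T (real n) (x i))) \<longlonglongrightarrow> T 0 (T (real n) (x i))"
      using t0 t by (intro continuous_on_tendsto_compose[OF continuous_on_T]) auto
    then have 1: "(\<lambda>j. norm (T (t j) (T (real n) (x i)) - T (real n) (x i))) \<longlonglongrightarrow> 0"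
      by (auto intro: tendsto_norm_zero LIM_zero)
    have 2: "norm (T (t j) (T (real n) (x j)) + T (real n) (x j))
        \<le> K * (C / real (Suc j) + \<bar>1 - exp (\<beta> * t j)\<bar>)" for j
    proof -
      have "T (t j) (T (real n) (x j)) = T (real n) (T (t j) (x j))"
        using T_add[of "t j" "real n" "x j"] T_add[of "real n" "t j" "x j"] t(1)
        by (simp add: add.commute)
      then have "norm (T (t j) (T (real n) (x j)) + T (real n) (x j)) = norm (T (real n) (T (t j) (x j) + x j))"
        by (simp add: linear_add[OF T_linear])
      also have "\<dots> \<le> K * norm (T (t j) (x j) + x j)" using n by (intro K(2)) auto
      also have "\<dots> \<le> K * (C / real (Suc j) + \<bar>1 - exp (\<beta> * t j)\<bar>)"
      proof (rule mult_left_mono)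
        have "T (t j) (x j) + x j = (T (t j) (x j) - exp (l j * of_real (t j)) *\<^sub>C x j)
            + of_real (1 - exp (\<beta> * t j)) *\<^sub>C x j"
          unfolding flip by (simp add: complex_vector.scale_left_diff_distrib)
        then have "norm (T (t j) (x j) + x j) \<le> norm (T (t j) (x j) - exp (l j * of_real (t j)) *\<^sub>C x j)
            + norm (of_real (1 - exp (\<beta> * t j)) *\<^sub>C x j)"
          using norm_triangle_ineq by metis
        moreover have "norm (of_real (1 - exp (\<beta> * t j)) *\<^sub>C x j) = \<bar>1 - exp (\<beta> * t j)\<bar>"
          unfolding norm_scaleC x(2) norm_of_real by simp
        moreover have "t j \<le> real N + 1" using t(2)[of j] by linarith
        ultimately show "norm (T (t j) (x j) + x j) \<le> C / real (Suc j) + \<bar>1 - exp (\<beta> * t j)\<bar>"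
          using C(2)[OF t(1), of j j] by linarith
      qed (use K in simp)
      finally show ?thesis .
    qed
    have "(\<lambda>j. K * (C / real (Suc j) + \<bar>1 - exp (\<beta> * t j)\<bar>)) \<longlonglongrightarrow> K * (0 + \<bar>1 - exp (\<beta> * 0)\<bar>)"
      using over t0 by (intro tendsto_intros)
    then have "(\<lambda>j. K * (C / real (Suc j) + \<bar>1 - exp (\<beta> * t j)\<bar>)) \<longlonglongrightarrow> 0" by simp
    then have "(\<lambda>j. T (t j) (T (real n) (x j)) + T (real n) (x j)) \<longlonglongrightarrow> 0"
      by (rule Lim_null_comparison[OF always_eventually[OF allI[OF 2]]])
    then have "(\<lambda>j. norm (T (t j) (T (real n) (x j)) + T (real n) (x j))) \<longlonglongrightarrow> 0"
      by (rule tendsto_norm_zero)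
    from tendsto_add[OF 1 this] show ?thesis by (simp add: err_def[abs_def])
  qed
  obtain i0 where i0: "\<And>i. i \<ge> i0 \<Longrightarrow> C / real (Suc i) < exp (- \<bar>b\<bar> * real N) / 4"
  proof -
    have "\<forall>\<^sub>F i in sequentially. C / real (Suc i) < exp (- \<bar>b\<bar> * real N) / 4"
      by (rule order_tendstoD(2)[OF over]) simp
    then show thesis using that unfolding eventually_sequentially by blast
  qed
  define good where "good i j \<longleftrightarrow> (\<forall>n\<le>N. c * exp (b * real n) \<le> norm (T (real n) (x i - x j)))" for i j
  have ev: "\<forall>\<^sub>F j in sequentially. good i j" if i: "i \<ge> i0" for i
  proof -
    have "\<forall>\<^sub>F j in sequentially. \<forall>n\<in>{..N}. err i n j < exp (b * real n) / 2"
      by (intro eventually_ball_finite ballI order_tendstoD(2)[OF err]) simp_all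
    then show ?thesis
    proof eventually_elim
      case (elim j)
      show ?case
        unfolding good_def
      proof (intro allI impI)
        fix n assume n: "n \<le> N"
        define w where "w i = T (real n) (x i)" for i
        have e: "exp (b * real n) \<le> exp (\<beta> * real n)" using \<beta> by (simp add: mult_right_mono)
        have "exp (\<beta> * real n) = norm (exp (l i * of_real (real n)) *\<^sub>C x i)"
          by (simp add: norm_scaleC x(2) l_def)
        also have "\<dots> \<le> norm (w i) + norm (w i - exp (l i * of_real (real n)) *\<^sub>C x i)"
          by (metis norm_minus_commute norm_triangle_sub)
        also have "\<dots> \<le> norm (w i) + exp (b * real n) / 4"
        proof -
          have "norm (w i - exp (l i * of_real (real n)) *\<^sub>C x i) \<le> C / real (Suc i)"
            unfolding w_def using n by (intro C(2)) auto
          then show ?thesis using i0[OF i] exp_ge_exp_neg[OF n, of b] by linarith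
        qed
        finally have wi: "3/4 * exp (b * real n) \<le> norm (w i)" using e by linarith
        (* T (t j) almost fixes w i and almost maps w j to - w j. *)
        have "2 *\<^sub>R w i = (w i - w j) + T (t j) (w i - w j) + (T (t j) (w j) + w j) - (T (t j) (w i) - w i)"
          by (simp add: T_diff t scaleR_2)
        then have "2 * norm (w i) = norm ((w i - w j) + T (t j) (w i - w j) + (T (t j) (w j) + w j) - (T (t j) (w i) - w i))"
          by (metis abs_numeral norm_scaleR)
        also have "\<dots> \<le> norm (w i - w j) + norm (T (t j) (w i - w j)) + err i n j"
          unfolding err_def w_def[symmetric]
          by (smt (verit) norm_triangle_ineq norm_triangle_ineq4)
        also have "\<dots> \<le> norm (w i - w j) + M * norm (w i - w j) + exp (b * real n) / 2"
        proof -
          have "err i n j < exp (b * real n) / 2" using elim n by simp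
          then show ?thesis using M(2)[OF t(1) t(2), of j "w i - w j"] by linarith
        qed
        finally have "exp (b * real n) \<le> (M + 1) * norm (w i - w j)"
          using wi unfolding distrib_right by linarith
        then have "1 / (M + 1) * exp (b * real n) \<le> norm (w i - w j)"
          using M(1) by (simp add: field_simps)
        moreover have "c * exp (b * real n) \<le> 1 / (M + 1) * exp (b * real n)"
          using c by (intro mult_right_mono) auto
        ultimately show "c * exp (b * real n) \<le> norm (T (real n) (x i - x j))"
          by (simp add: w_def T_diff)
      qed
    qed
  qed
  have "\<exists>n>m. \<forall>i\<le>m. good (i0 + i) (i0 + n)" for m
  proof -
    have "\<forall>\<^sub>F j in sequentially. \<forall>i\<in>{..m}. good (i0 + i) j"
      by (intro eventually_ball_finite ballI ev) simp_all
    then obtain J where "\<And>j i. j \<ge> J \<Longrightarrow> i \<le> m \<Longrightarrow> good (i0 + i) j"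
      unfolding eventually_sequentially by auto
    then show ?thesis by (intro exI[of _ "J + Suc m"]) auto
  qed
  then obtain h :: "nat \<Rightarrow> nat" where "\<And>i j. i < j \<Longrightarrow> good (i0 + h i) (i0 + h j)"
    using subsequence_of_good_pairs[of "\<lambda>i j. good (i0 + i) (i0 + j)"] by blast
  then have "separated b c N"
    unfolding separated_def using x(2) by (intro exI[of _ "\<lambda>i. x (i0 + h i)"]) (auto simp: good_def)
  with ns show False ..
qed

lemma resolvent_bound_le:
  assumes ns: "\<not> separated b c N" and c: "c \<le> 1 / (M + 3)"
    and M: "M \<ge> 1" "\<And>t x. 0 \<le> t \<Longrightarrow> t \<le> 1 \<Longrightarrow> norm (T t x) \<le> M * norm x"
  shows "resolvent_bound D A \<le> ereal b"
proof (rule ereal_le_epsilon2)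
  fix e :: real assume e: "e > 0"
  have c4: "c \<le> 1/4" using order_trans[OF c, of "1/4"] M(1) by (simp add: field_simps)
  have cM: "c \<le> 1 / (M + 1)" using order_trans[OF c, of "1 / (M + 1)"] M(1) by (simp add: field_simps)
  define \<beta> where "\<beta> = b + e"
  have \<beta>: "b < \<beta>" using e by (simp add: \<beta>_def)
  have "essential_spectral_bound D A \<le> ereal b"
    unfolding essential_spectral_bound_def
  proof (rule SUP_least)
    fix l assume "l \<in> essential_spectrum D A"
    then have "\<not> fredholm D (pencil l)" by (simp add: essential_spectrum_def)
    then show "ereal (Re l) \<le> ereal b" using fredholm_pencil[OF ns c4, of l] by force
  qed
  also have "ereal b < ereal \<beta>" using \<beta> by simp
  finally have 1: "essential_spectral_bound D A < ereal \<beta>" .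
  have "finite (point_spectrum D A \<inter> {l. b \<le> Re l})"
    using finite_point_spectrum[OF ns] c4 by simp
  then have 2: "finite (point_spectrum D A \<inter> {l. Re l = \<beta>})"
    by (rule finite_subset[rotated]) (use \<beta> in auto)
  obtain R \<kappa> where \<kappa>: "\<kappa> > 0" "\<And>s. R \<le> \<bar>s\<bar> \<Longrightarrow> bounded_below \<kappa> (Complex \<beta> s)"
    using bounded_below_vertical_line[OF ns cM M less_imp_le[OF \<beta>]] by blast
  have ev: "\<forall>\<^sub>F s in at_infinity. R \<le> \<bar>s\<bar>" unfolding eventually_at_infinity by auto
  have on: "onto (Complex \<beta> s)" if "R \<le> \<bar>s\<bar>" for s
  proof (rule onto_off_spectrum[OF ns c4])
    show "Complex \<beta> s \<notin> point_spectrum D A"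
    proof
      assume "Complex \<beta> s \<in> point_spectrum D A"
      then obtain x where "x \<in> D" "x \<noteq> 0" "A x = Complex \<beta> s *\<^sub>C x" by (auto simp: point_spectrum_def)
      then show False using \<kappa>(2)[OF that] \<kappa>(1) by (auto simp: bounded_below_def mult_le_0_iff)
    qed
  qed (use \<beta> in simp)
  have 3: "\<forall>\<^sub>F s in at_infinity. Complex \<beta> s \<in> resolvent_set D A"
    using ev by eventually_elim (use mem_resolvent_set[OF \<kappa>(2,1) on] in blast)
  have "\<forall>\<^sub>F s in at_infinity. ereal (onorm (resolvent D A (Complex \<beta> s))) \<le> ereal (1 / \<kappa>)"
    using ev by eventually_elim (use onorm_resolvent_le[OF \<kappa>(2,1) on] in simp)
  then have "Limsup at_infinity (\<lambda>s. ereal (onorm (resolvent D A (Complex \<beta> s)))) \<le> ereal (1 / \<kappa>)"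
    by (rule Limsup_bounded)
  then have 4: "Limsup at_infinity (\<lambda>s. ereal (onorm (resolvent D A (Complex \<beta> s)))) < \<infinity>"
    by (rule le_less_trans) simp
  have "resolvent_bound D A \<le> ereal \<beta>"
    unfolding resolvent_bound_def by (rule INF_lower) (use 1 2 3 4 in simp)
  then show "resolvent_bound D A \<le> ereal b + ereal e" by (simp add: \<beta>_def)
qed

text \<open>Separation holds for every \<open>b\<close> below the resolvent bound with the same constant. For fixed \<open>N\<close>, taking
\<open>b\<close> close enough to \<open>s\<close> costs only a factor \<open>2\<close>. For large \<open>b\<close> separation contradicts the boundedness of
\<open>T 1\<close>, which is why the resolvent bound is not \<open>\<infinity>\<close>.\<close>

theorem separated_below_resolvent_bound:
  obtains c where "c > 0" "resolvent_bound D A < \<infinity>"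
    "\<And>s N. resolvent_bound D A = ereal s \<Longrightarrow> separated s c N"
proof -
  obtain M where M: "M \<ge> 1" "\<And>t x. 0 \<le> t \<Longrightarrow> t \<le> 1 \<Longrightarrow> norm (T t x) \<le> M * norm x"
    using T_bounded[of 1] by auto
  define c where "c = 1 / (M + 3)"
  have c: "c > 0" using M by (simp add: c_def)
  have *: "resolvent_bound D A \<le> ereal b" if "\<not> separated b c N" for b N
    using resolvent_bound_le[OF that _ M] by (simp add: c_def)
  define b where "b = ln (3 * M / c)"
  have "\<not> separated b c 1"
  proof
    assume "separated b c 1"
    then obtain x where x: "\<And>i. norm (x i) \<le> 1"
      "\<And>i j n. i < j \<Longrightarrow> n \<le> 1 \<Longrightarrow> c * exp (b * real n) \<le> norm (T (real n) (x i - x (j::nat)))"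
      unfolding separated_def by blast
    have "c * exp (b * real 1) \<le> norm (T (real 1) (x 0 - x 1))" by (rule x(2)) auto
    also have "\<dots> \<le> M * norm (x 0 - x 1)" using M(2)[of 1] by simp
    also have "\<dots> \<le> M * 2"
      using M(1) norm_triangle_ineq4[of "x 0" "x 1"] x(1)[of 0] x(1)[of 1] by (intro mult_left_mono) auto
    finally show False using M(1) c by (simp add: b_def)
  qed
  then have "resolvent_bound D A \<le> ereal b" by (rule *)
  then have "resolvent_bound D A < \<infinity>" by (rule le_less_trans) simp
  moreover have "separated s (c / 2) N" if s: "resolvent_bound D A = ereal s" for s N
  proof -
    (* Chosen so that exp ((s - b) * n) \<le> 2 for n \<le> N. *)
    define b where "b = s - ln 2 / (real N + 1)"
    have "b < s" by (simp add: b_def)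
    then have "separated b c N" using *[of b N] s by (metis ereal_less_eq(3) not_less)
    then obtain x where x: "\<And>i. norm (x i) \<le> 1"
      "\<And>i j n. i < j \<Longrightarrow> n \<le> N \<Longrightarrow> c * exp (b * real n) \<le> norm (T (real n) (x i - x (j::nat)))"
      unfolding separated_def by blast
    have "c / 2 * exp (s * real n) \<le> c * exp (b * real n)" if "n \<le> N" for n
    proof -
      have "ln 2 / (real N + 1) * real n \<le> ln 2 / (real N + 1) * (real N + 1)"
        using that by (intro mult_left_mono) auto
      also have "\<dots> = ln 2" by simp
      finally have "s * real n \<le> b * real n + ln 2" by (simp add: b_def left_diff_distrib)
      then have "exp (s * real n) \<le> exp (b * real n + ln 2)" by simp
      also have "\<dots> = 2 * exp (b * real n)" by (simp add: exp_add)
      finally show ?thesis using c by simp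
    qed
    then show ?thesis unfolding separated_def using x by (meson order_trans)
  qed
  ultimately show thesis using that[of "c / 2"] c by simp
qed

end

section \<open>Orbits that escape totally bounded sets\<close>

definition totally_bounded :: "'a::metric_space set \<Rightarrow> bool" where
  "totally_bounded P \<longleftrightarrow> (\<forall>e>0. \<exists>F. finite F \<and> P \<subseteq> (\<Union>x\<in>F. ball x e))"

lemma totally_boundedI:
  assumes "\<And>e. e > 0 \<Longrightarrow> \<exists>C. compact C \<and> (\<forall>p\<in>P. \<exists>c\<in>C. dist p c \<le> e)"
  shows "totally_bounded P"
  unfolding totally_bounded_def
proof (intro allI impI)
  fix e :: real assume e: "e > 0"
  then obtain C where C: "compact C" "\<And>p. p \<in> P \<Longrightarrow> \<exists>c\<in>C. dist p c \<le> e/2"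
    using assms[of "e/2"] by auto
  obtain F where F: "finite F" "C \<subseteq> (\<Union>x\<in>F. ball x (e/2))"
    using C(1) e unfolding compact_eq_totally_bounded by (metis half_gt_zero)
  have "P \<subseteq> (\<Union>x\<in>F. ball x e)"
  proof
    fix p assume "p \<in> P"
    then obtain c where c: "c \<in> C" "dist p c \<le> e/2" using C(2) by blast
    then obtain x where "x \<in> F" "dist x c < e/2" using F(2) by auto
    then show "p \<in> (\<Union>x\<in>F. ball x e)"
      using c(2) dist_triangle[of x p c] by (auto simp: dist_commute intro!: bexI[of _ x])
  qed
  with F(1) show "\<exists>F. finite F \<and> P \<subseteq> (\<Union>x\<in>F. ball x e)" by blast
qed

lemma totally_bounded_affine_image:
  fixes P :: "'a::real_normed_vector set"
  assumes "totally_bounded P"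
  shows "totally_bounded ((\<lambda>p. l + a *\<^sub>R p) ` P)"
  unfolding totally_bounded_def
proof (intro allI impI)
  fix e :: real assume e: "e > 0"
  then have e': "e / (\<bar>a\<bar> + 1) > 0" by simp
  then obtain F where F: "finite F" "P \<subseteq> (\<Union>x\<in>F. ball x (e / (\<bar>a\<bar> + 1)))"
    using assms unfolding totally_bounded_def by blast
  have "(\<lambda>p. l + a *\<^sub>R p) ` P \<subseteq> (\<Union>x\<in>(\<lambda>p. l + a *\<^sub>R p) ` F. ball x e)"
  proof (rule image_subsetI)
    fix p assume "p \<in> P"
    then obtain x where x: "x \<in> F" "dist x p < e / (\<bar>a\<bar> + 1)" using F(2) by auto
    have "dist (l + a *\<^sub>R x) (l + a *\<^sub>R p) = \<bar>a\<bar> * dist x p"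
      by (simp add: dist_norm flip: scaleR_diff_right)
    also have "\<dots> \<le> \<bar>a\<bar> * (e / (\<bar>a\<bar> + 1))" using x(2) by (intro mult_left_mono) auto
    also have "\<dots> < e" using e by (simp add: field_simps)
    finally show "l + a *\<^sub>R p \<in> (\<Union>x\<in>(\<lambda>p. l + a *\<^sub>R p) ` F. ball x e)" using x(1) by auto
  qed
  with F(1) show "\<exists>F. finite F \<and> (\<lambda>p. l + a *\<^sub>R p) ` P \<subseteq> (\<Union>x\<in>F. ball x e)" by blast
qed

text \<open>If every pair \<open>i < j\<close> were bad for some \<open>n\<close> and \<open>l\<close>, Ramsey's theorem would give one choice of \<open>n\<close> and
\<open>l\<close> for which all pairs of a subsequence are bad. The average of \<open>l + V n (x (k+1) - x k)\<close> over \<open>m\<close>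
consecutive pairs then has norm at most \<open>norm l - \<epsilon>\<close>, but by telescoping it tends to \<open>l\<close>.\<close>

lemma invisible_difference:
  fixes V :: "nat \<Rightarrow> 'a::real_normed_vector \<Rightarrow> 'a" and x :: "nat \<Rightarrow> 'a"
  assumes V: "\<And>n. bounded_linear (V n)" and x: "bounded (range x)"
    and L: "\<And>n. finite (L n)" and \<epsilon>: "\<epsilon> > 0"
  obtains i j where "i < j" "\<And>n l. n \<le> N \<Longrightarrow> l \<in> L n \<Longrightarrow> norm l - \<epsilon> \<le> norm (l + V n (x j - x i))"
proof (rule ccontr)
  assume no: "\<not> thesis"
  note pair = that
  have "\<exists>n l. n \<le> N \<and> l \<in> L n \<and> norm (l + V n (x j - x i)) < norm l - \<epsilon>" if ij: "i < j" for i j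
    using no pair[OF ij] by (meson not_le)
  then have "\<exists>p. i < j \<longrightarrow> fst p \<le> N \<and> snd p \<in> L (fst p) \<and>
      norm (snd p + V (fst p) (x j - x i)) < norm (snd p) - \<epsilon>" for i j
    by (cases "i < j") (metis fst_conv snd_conv, simp)
  then obtain col where col: "\<And>i j. i < j \<Longrightarrow> fst (col i j) \<le> N \<and> snd (col i j) \<in> L (fst (col i j)) \<and>
      norm (snd (col i j) + V (fst (col i j)) (x j - x i)) < norm (snd (col i j)) - \<epsilon>"
    by metis
  have "col i j \<in> (SIGMA n:{..N}. L n)" if "i < j" for i j
    using col[OF that] by (cases "col i j") auto
  moreover have "finite (SIGMA n:{..N}. L n)" using L by blast
  ultimately obtain h :: "nat \<Rightarrow> nat" and c where h: "strict_mono h"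
    and c: "\<And>i j. i < j \<Longrightarrow> col (h i) (h j) = c"
    using Ramsey_sequence[of "SIGMA n:{..N}. L n" col] by metis
  obtain n l where nl: "c = (n, l)" by (cases c)
  interpret bounded_linear "V n" by (rule V)
  have bad: "norm (l + V n (x (h (Suc k)) - x (h k))) \<le> norm l - \<epsilon>" for k
    using col[of "h k" "h (Suc k)"] c[of k "Suc k"] strict_monoD[OF h, of k "Suc k"] nl by simp
  have tele: "(\<Sum>k<m. l + V n (x (h (Suc k)) - x (h k))) = real m *\<^sub>R l + V n (x (h m) - x (h 0))" for m
    by (induction m) (simp_all add: diff algebra_simps zero)
  obtain B where B: "\<And>i. norm (x i) \<le> B" using x by (auto simp: bounded_iff)
  obtain K where K: "K > 0" "\<And>v. norm (V n v) \<le> norm v * K" using pos_bounded by blast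
  have "real m * \<epsilon> \<le> 2 * B * K" for m
  proof -
    have "norm (real m *\<^sub>R l) \<le> norm (real m *\<^sub>R l + V n (x (h m) - x (h 0))) + norm (V n (x (h m) - x (h 0)))"
      by (metis add_diff_cancel_right' norm_triangle_ineq4)
    also have "norm (real m *\<^sub>R l + V n (x (h m) - x (h 0))) \<le> (\<Sum>k<m. norm l - \<epsilon>)"
      unfolding tele[symmetric] by (rule sum_norm_le) (use bad in simp)
    also have "norm (V n (x (h m) - x (h 0))) \<le> 2 * B * K"
    proof -
      have "norm (x (h m) - x (h 0)) \<le> 2 * B"
        using norm_triangle_ineq4[of "x (h m)" "x (h 0)"] B[of "h m"] B[of "h 0"] by linarith
      then show ?thesis using K(2)[of "x (h m) - x (h 0)"] K(1)
        by (meson less_imp_le mult_right_mono order_trans)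
    qed
    finally show ?thesis by (simp add: algebra_simps)
  qed
  moreover obtain m :: nat where "real m * \<epsilon> > 2 * B * K" using reals_Archimedean3[OF \<epsilon>] by blast
  ultimately show False by (meson not_le)
qed

text \<open>Both lower bounds come from the same fact: adding \<open>V n v\<close> hardly decreases the norm of \<open>w = V n p + q\<close>.
The second follows since \<open>norm (w + V n v)\<close> is also at least \<open>norm (V n v) - norm w\<close>, and one of the two
bounds is at least about half of \<open>norm (V n v)\<close>, whatever \<open>w\<close> is.\<close>

lemma escape_step:
  fixes V :: "nat \<Rightarrow> 'a::real_normed_vector \<Rightarrow> 'a"
  assumes V: "\<And>n. bounded_linear (V n)" and Q: "\<And>n. totally_bounded (Q n)"
    and x: "\<And>i. norm (x i) \<le> 1" "\<And>i j n. i < j \<Longrightarrow> n \<le> N \<Longrightarrow> c \<le> norm (V n (x i - x (j::nat)))"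
    and \<delta>: "\<delta> > 0" and \<epsilon>: "\<epsilon> > 0"
  obtains v where "norm v \<le> \<delta>"
    "\<And>n q. n \<le> N \<Longrightarrow> q \<in> Q n \<Longrightarrow> norm (V n p + q) - \<epsilon> \<le> norm (V n (p + v) + q)"
    "\<And>n q. n \<le> N \<Longrightarrow> q \<in> Q n \<Longrightarrow> c * \<delta> / 4 - \<epsilon> / 2 \<le> norm (V n (p + v) + q)"
proof -
  have "\<exists>F. finite F \<and> (\<lambda>q. V n p + 1 *\<^sub>R q) ` Q n \<subseteq> (\<Union>l\<in>F. ball l (\<epsilon> / 3))" for n
    using totally_bounded_affine_image[OF Q[of n], of "V n p" 1] \<epsilon>
    unfolding totally_bounded_def by (meson divide_pos_pos zero_less_numeral)
  then obtain L where L: "\<And>n. finite (L n)" "\<And>n. (\<lambda>q. V n p + 1 *\<^sub>R q) ` Q n \<subseteq> (\<Union>l\<in>L n. ball l (\<epsilon> / 3))"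
    by metis
  define z where "z i = (\<delta> / 2) *\<^sub>R x i" for i
  have "norm (z i) \<le> \<delta> / 2" for i
    using x(1)[of i] \<delta> by (simp add: z_def mult_left_le)
  then have "bounded (range z)" unfolding bounded_iff by blast
  then obtain i j where ij: "i < j"
    "\<And>n l. n \<le> N \<Longrightarrow> l \<in> L n \<Longrightarrow> norm l - \<epsilon> / 3 \<le> norm (l + V n (z j - z i))"
    using invisible_difference[of V z L "\<epsilon> / 3" N] V L(1) \<epsilon> by (metis divide_pos_pos zero_less_numeral)
  define v where "v = z j - z i"
  have v: "norm v \<le> \<delta>"
    using norm_triangle_ineq4[of "z j" "z i"] \<open>\<And>i. norm (z i) \<le> \<delta> / 2\<close>[of i] \<open>\<And>i. norm (z i) \<le> \<delta> / 2\<close>[of j]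
    unfolding v_def by linarith
  have keep: "norm (V n p + q) - \<epsilon> \<le> norm (V n (p + v) + q)"
    and gain: "c * \<delta> / 4 - \<epsilon> / 2 \<le> norm (V n (p + v) + q)" if n: "n \<le> N" and q: "q \<in> Q n" for n q
  proof -
    interpret bounded_linear "V n" by (rule V)
    define w where "w = V n p + q"
    obtain l where l: "l \<in> L n" "dist l w < \<epsilon> / 3" using L(2)[of n] q by (auto simp: w_def)
    have eq: "V n (p + v) + q = w + V n v" by (simp add: add w_def)
    have d: "norm (l - w) < \<epsilon> / 3" using l(2) by (simp add: dist_norm)
    have "norm l - \<epsilon> / 3 \<le> norm (l + V n v)" unfolding v_def by (rule ij(2)[OF n l(1)])
    moreover have "norm (l + V n v) \<le> norm (w + V n v) + norm (l - w)"
      using norm_triangle_ineq[of "w + V n v" "l - w"] by (simp add: algebra_simps)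
    moreover have "norm w \<le> norm l + norm (l - w)"
      using norm_triangle_ineq4[of l "l - w"] by simp
    ultimately have k: "norm w - \<epsilon> \<le> norm (w + V n v)" using d by linarith
    then show "norm (V n p + q) - \<epsilon> \<le> norm (V n (p + v) + q)" unfolding eq by (simp add: w_def)
    have "v = (- (\<delta> / 2)) *\<^sub>R (x i - x j)" by (simp add: v_def z_def algebra_simps)
    then have "norm (V n v) = \<delta> / 2 * norm (V n (x i - x j))"
      using \<delta> by (simp only: scaleR norm_scaleR) 
    then have "c * \<delta> / 2 \<le> norm (V n v)"
      using mult_left_mono[OF x(2)[OF ij(1) n], of "\<delta> / 2"] \<delta> by (simp add: algebra_simps)
    moreover have "norm (V n v) \<le> norm (w + V n v) + norm w"
      using norm_triangle_ineq4[of "w + V n v" w] by simp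
    ultimately show "c * \<delta> / 4 - \<epsilon> / 2 \<le> norm (V n (p + v) + q)" unfolding eq using k by linarith
  qed
  show thesis by (rule that[OF v keep gain])
qed

text \<open>The partial sums \<open>p k\<close> are obtained from \<open>y\<close> by steps of size at most \<open>\<delta> k = r / 2^(k+1)\<close>. Step \<open>k\<close>
creates the lower bound for \<open>n\<close> between \<open>N k\<close> and \<open>N (k+1)\<close>, where \<open>\<alpha> n\<close> is already small compared with
\<open>\<delta> k\<close>, and preserves the lower bounds for smaller \<open>n\<close> up to \<open>\<epsilon> k\<close>. It is essential that \<open>c\<close> does not
depend on the length of the blocks, since \<open>N k\<close> has to be chosen before the sequence of step \<open>k\<close>.\<close>

theorem orbit_escaping_totally_bounded_sets:
  fixes V :: "nat \<Rightarrow> 'a::banach \<Rightarrow> 'a"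
  assumes V: "\<And>n. bounded_linear (V n)" and Q: "\<And>n. totally_bounded (Q n)"
    and c: "c > 0"
    and sep: "\<And>N. \<exists>x. (\<forall>i. norm (x i) \<le> 1) \<and>
       (\<forall>i j n. i < j \<longrightarrow> n \<le> N \<longrightarrow> c \<le> norm (V n (x i - x (j::nat))))"
    and \<alpha>: "\<alpha> \<longlonglongrightarrow> 0" and r: "r > 0"
  obtains x0 n0 where "x0 \<in> cball y r" "\<And>n q. n \<ge> n0 \<Longrightarrow> q \<in> Q n \<Longrightarrow> \<alpha> n \<le> norm (V n x0 + q)"
proof -
  define \<delta> where "\<delta> k = r / 2 ^ Suc k" for k :: nat
  have \<delta>: "\<delta> k > 0" "\<delta> k = 2 * \<delta> (Suc k)" for k using r by (simp_all add: \<delta>_def)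
  (* The losses \<epsilon> j with j > k sum up to at most c * \<delta> k / 16, so they leave more than
  half of the bound c * \<delta> k / 4 - \<epsilon> k / 2 created by step k. *)
  define \<epsilon> where "\<epsilon> k = c * \<delta> k / 16" for k
  have \<epsilon>: "\<epsilon> k > 0" for k using \<delta>(1) c by (simp add: \<epsilon>_def)
  have "\<exists>M. \<forall>n\<ge>M. \<alpha> n \<le> c * \<delta> k / 8" for k
  proof -
    have "c * \<delta> k / 8 > 0" using \<delta>(1) c by simp
    from order_tendstoD(2)[OF \<alpha> this] show ?thesis
      unfolding eventually_sequentially by (meson less_imp_le)
  qed
  then obtain M where M: "\<And>k n. n \<ge> M k \<Longrightarrow> \<alpha> n \<le> c * \<delta> k / 8" by metis
  define N where "N k = (\<Sum>j\<le>k. Suc (M j))" for k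
  have N_mono: "strict_mono N" by (simp add: strict_mono_Suc_iff N_def)
  have N_M: "M k \<le> N k" for k by (cases k) (auto simp: N_def)
  have step: "\<exists>v. norm v \<le> \<delta> k \<and>
      (\<forall>n q. n \<le> N (Suc k) \<longrightarrow> q \<in> Q n \<longrightarrow> norm (V n p + q) - \<epsilon> k \<le> norm (V n (p + v) + q)) \<and>
      (\<forall>n q. n \<le> N (Suc k) \<longrightarrow> q \<in> Q n \<longrightarrow> c * \<delta> k / 4 - \<epsilon> k / 2 \<le> norm (V n (p + v) + q))" for k p
  proof -
    obtain x where x: "\<And>i. norm (x i) \<le> 1"
      "\<And>i j n. i < j \<Longrightarrow> n \<le> N (Suc k) \<Longrightarrow> c \<le> norm (V n (x i - x (j::nat)))"
      using sep by blast
    show ?thesis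
      by (rule escape_step[where V=V and Q=Q and x=x and N="N (Suc k)" and c=c and \<delta>="\<delta> k"
            and \<epsilon>="\<epsilon> k" and p=p, OF V Q x \<delta>(1) \<epsilon>]) blast+
  qed
  define step_v where "step_v k p = (SOME v. norm v \<le> \<delta> k \<and>
      (\<forall>n q. n \<le> N (Suc k) \<longrightarrow> q \<in> Q n \<longrightarrow> norm (V n p + q) - \<epsilon> k \<le> norm (V n (p + v) + q)) \<and>
      (\<forall>n q. n \<le> N (Suc k) \<longrightarrow> q \<in> Q n \<longrightarrow> c * \<delta> k / 4 - \<epsilon> k / 2 \<le> norm (V n (p + v) + q)))" for k p
  define p where "p = rec_nat y (\<lambda>k p. p + step_v k p)"
  have p0: "p 0 = y" and pS: "p (Suc k) = p k + step_v k (p k)" for k by (simp_all add: p_def)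
  have size: "norm (p (Suc k) - p k) \<le> \<delta> k"
    and keep: "\<And>n q. n \<le> N (Suc k) \<Longrightarrow> q \<in> Q n \<Longrightarrow> norm (V n (p k) + q) - \<epsilon> k \<le> norm (V n (p (Suc k)) + q)"
    and gain: "\<And>n q. n \<le> N (Suc k) \<Longrightarrow> q \<in> Q n \<Longrightarrow> c * \<delta> k / 4 - \<epsilon> k / 2 \<le> norm (V n (p (Suc k)) + q)" for k
    using someI_ex[OF step[of k "p k"]] unfolding pS step_v_def by simp_all
  have dist_y: "norm (p m - y) \<le> r - 2 * \<delta> m" for m
  proof (induction m)
    case 0
    then show ?case by (simp add: p0 \<delta>_def)
  next
    case (Suc m)
    have "norm (p (Suc m) - y) \<le> norm (p (Suc m) - p m) + norm (p m - y)"
      by (metis diff_add_cancel add_diff_eq norm_triangle_ineq)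
    then show ?case using size[of m] Suc \<delta>(2)[of m] by linarith
  qed
  have "summable \<delta>"
    using summable_mult[OF summable_geometric[of "1/2::real"], of "r / 2"]
    by (simp add: \<delta>_def[abs_def] power_divide)
  then have "summable (\<lambda>k. norm (p (Suc k) - p k))"
    by (rule summable_comparison_test'[where N=0]) (use size in auto)
  then have "summable (\<lambda>k. p (Suc k) - p k)" by (rule summable_norm_cancel)
  then have "convergent p" unfolding summable_iff_convergent sum_lessThan_telescope
    using convergent_diff_const_right_iff by blast
  then obtain x0 where x0: "p \<longlonglongrightarrow> x0" by (auto simp: convergent_def)
  have "norm (x0 - y) \<le> r"
  proof (rule LIMSEQ_le_const2)
    show "(\<lambda>m. norm (p m - y)) \<longlonglongrightarrow> norm (x0 - y)" using x0 by (intro tendsto_intros)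
    have "norm (p m - y) \<le> r" for m using dist_y[of m] \<delta>(1)[of m] by linarith
    then show "\<exists>N. \<forall>m\<ge>N. norm (p m - y) \<le> r" by blast
  qed
  then have ball: "x0 \<in> cball y r" by (simp add: dist_norm norm_minus_commute)
  have "\<alpha> n \<le> norm (V n x0 + q)" if n: "n \<ge> N 0" and q: "q \<in> Q n" for n q
  proof -
    interpret bounded_linear "V n" by (rule V)
    obtain k where k: "N k \<le> n" "n \<le> N (Suc k)"
    proof -
      define k where "k = (LEAST k. n < N (Suc k))"
      have ex: "n < N (Suc n)" using strict_mono_imp_increasing[OF N_mono, of "Suc n"] by linarith
      have "n < N (Suc k)" unfolding k_def by (rule LeastI[of "\<lambda>k. n < N (Suc k)", OF ex])
      moreover have "N k \<le> n"
      proof (cases k)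
        case (Suc k')
        then show ?thesis using not_less_Least[of k' "\<lambda>k. n < N (Suc k)"] by (auto simp: k_def)
      qed (use n in simp)
      ultimately show thesis using that by simp
    qed
    have inv: "c * \<delta> k / 8 + c * \<delta> m / 8 \<le> norm (V n (p m) + q)" if "m \<ge> Suc k" for m
      using that
    proof (induction rule: dec_induct)
      case base
      have "c * \<delta> k / 4 - \<epsilon> k / 2 \<le> norm (V n (p (Suc k)) + q)" by (rule gain[OF k(2) q])
      moreover have "c * \<delta> k = 2 * (c * \<delta> (Suc k))" using \<delta>(2)[of k] by simp
      moreover have "c * \<delta> (Suc k) > 0" using \<delta>(1) c by simp
      ultimately show ?case unfolding \<epsilon>_def by linarith
    next
      case (step m)
      have "n \<le> N (Suc m)"
        using k(2) strict_mono_less_eq[OF N_mono, of "Suc k" "Suc m"] step.hyps by linarith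
      then have "norm (V n (p m) + q) - \<epsilon> m \<le> norm (V n (p (Suc m)) + q)" using q by (rule keep)
      moreover have "c * \<delta> m = 2 * (c * \<delta> (Suc m))" using \<delta>(2)[of m] by simp
      ultimately show ?case using step.IH unfolding \<epsilon>_def by linarith
    qed
    have "(\<lambda>m. norm (V n (p m) + q)) \<longlonglongrightarrow> norm (V n x0 + q)"
      using x0 by (intro tendsto_intros tendsto)
    moreover have "c * \<delta> k / 8 \<le> norm (V n (p m) + q)" if "m \<ge> Suc k" for m
      using inv[OF that] \<delta>(1)[of m] c mult_pos_pos[OF c \<delta>(1)[of m]] by linarith
    ultimately have "c * \<delta> k / 8 \<le> norm (V n x0 + q)"
      by (intro LIMSEQ_le_const) auto
    moreover have "\<alpha> n \<le> c * \<delta> k / 8" using M k(1) N_M[of k] by simp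
    ultimately show ?thesis by simp
  qed
  with ball show thesis by (rule that)
qed

section \<open>The integral perturbation is totally bounded\<close>

text \<open>Riemann sums of \<open>P\<close>-valued functions are \<open>t\<close> times convex combinations of points of \<open>P\<close>. Replacing these
points by those of a finite net changes the sum little and leaves it in the compact set
\<open>(\<tau> + 1) S\<close>, where \<open>S\<close> is the convex hull of the net and \<open>0\<close>.\<close>

lemma totally_bounded_integrals:
  fixes P :: "'a::real_normed_vector set" and \<tau> :: real
  assumes P: "totally_bounded P" and \<tau>: "\<tau> \<ge> 0"
  shows "totally_bounded {integral {0..t} f | t f. 0 \<le> t \<and> t \<le> \<tau> \<and> f integrable_on {0..t} \<and> (\<forall>s\<in>{0..t}. f s \<in> P)}"
proof (rule totally_boundedI)
  fix e :: real assume e: "e > 0"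
  define \<eta> where "\<eta> = e / (2 * (\<tau> + 1))"
  have \<eta>: "\<eta> > 0" using e \<tau> by (simp add: \<eta>_def)
  obtain F where F: "finite F" "P \<subseteq> (\<Union>x\<in>F. ball x \<eta>)" using P \<eta> unfolding totally_bounded_def by blast
  then have "\<forall>p\<in>P. \<exists>x. x \<in> F \<and> dist x p < \<eta>" by (auto simp: subset_iff Bex_def)
  from bchoice[OF this] obtain g
    where g: "\<And>p. p \<in> P \<Longrightarrow> g p \<in> F" "\<And>p. p \<in> P \<Longrightarrow> dist (g p) p < \<eta>" by blast
  define S where "S = convex hull (insert 0 F)"
  have S: "convex S" "0 \<in> S" "F \<subseteq> S" "compact S"
    using F(1) hull_subset[of "insert 0 F" convex] by (auto simp: S_def finite_imp_compact_convex_hull)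
  define C where "C = (\<lambda>x. (\<tau> + 1) *\<^sub>R x) ` S"
  have C: "compact C" unfolding C_def using S(4) by (rule compact_scaling)
  have C0: "0 \<in> C" unfolding C_def by (rule image_eqI[OF _ S(2)]) simp
  have "\<exists>c\<in>C. dist (integral {0..t} f) c \<le> e"
    if t: "0 \<le> t" "t \<le> \<tau>" and f: "f integrable_on {0..t}" "\<forall>s\<in>{0..t}. f s \<in> P" for t f
  proof (cases "t = 0")
    case True
    then show ?thesis using e by (intro bexI[OF _ C0]) simp
  next
    case False
    then have t0: "t > 0" using t by simp
    obtain \<gamma> where \<gamma>: "gauge \<gamma>" "\<And>\<D>. \<D> tagged_division_of {0..t} \<Longrightarrow> \<gamma> fine \<D> \<Longrightarrow>
        norm ((\<Sum>(x,k)\<in>\<D>. measure lborel k *\<^sub>R f x) - integral {0..t} f) < e / 2"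
      using integrable_integral[OF f(1)] e unfolding has_integral_real by (meson half_gt_zero)
    obtain \<D> where \<D>: "\<D> tagged_division_of {0..t}" "\<gamma> fine \<D>"
      using fine_division_exists_real[OF \<gamma>(1)] by blast
    have fin: "finite \<D>" using \<D>(1) by (rule tagged_division_of_finite)
    have inP: "f x \<in> P" if "(x, k) \<in> \<D>" for x k
      using tag_in_interval[OF \<D>(1)[folded box_real(2)] that] f(2) by (simp add: box_real)
    have total: "(\<Sum>(x,k)\<in>\<D>. measure lborel k) = t"
      using additive_content_tagged_division[OF \<D>(1)[folded box_real(2)]] t by simp
    define J where "J = (\<Sum>(x,k)\<in>\<D>. measure lborel k *\<^sub>R g (f x))"
    have "norm ((\<Sum>(x,k)\<in>\<D>. measure lborel k *\<^sub>R f x) - J) \<le> (\<Sum>(x,k)\<in>\<D>. measure lborel k * \<eta>)"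
      unfolding J_def sum_subtractf[symmetric]
    proof (rule sum_norm_le, clarify)
      fix x k assume xk: "(x, k) \<in> \<D>"
      have "norm (f x - g (f x)) \<le> \<eta>" using g(2)[OF inP[OF xk]] by (simp add: dist_norm norm_minus_commute)
      then show "norm (measure lborel k *\<^sub>R f x - measure lborel k *\<^sub>R g (f x)) \<le> measure lborel k * \<eta>"
        by (simp add: mult_left_mono flip: scaleR_diff_right)
    qed
    also have "\<dots> = t * \<eta>"
      unfolding total[symmetric] sum_distrib_right by (rule sum.cong) auto
    also have "\<dots> \<le> e / 2"
    proof -
      have "t * \<eta> \<le> (\<tau> + 1) * \<eta>" using t \<eta> by (intro mult_right_mono) auto
      also have "\<dots> = e / 2" using \<tau> by (simp add: \<eta>_def field_simps)
      finally show ?thesis .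
    qed
    finally have near: "norm ((\<Sum>(x,k)\<in>\<D>. measure lborel k *\<^sub>R f x) - J) \<le> e / 2" .
    have "dist (integral {0..t} f) J \<le> e"
      using near \<gamma>(2)[OF \<D>] norm_triangle_ineq[of "integral {0..t} f - (\<Sum>(x,k)\<in>\<D>. measure lborel k *\<^sub>R f x)"
          "(\<Sum>(x,k)\<in>\<D>. measure lborel k *\<^sub>R f x) - J"]
      by (simp add: dist_norm norm_minus_commute)
    moreover have "J \<in> C"
    proof -
      define z where "z = (\<Sum>p\<in>\<D>. (measure lborel (snd p) / t) *\<^sub>R g (f (fst p)))"
      have "z \<in> S"
        unfolding z_def
      proof (rule convex_sum[OF fin S(1)])
        have "(\<Sum>p\<in>\<D>. measure lborel (snd p) / t) = (\<Sum>(x,k)\<in>\<D>. measure lborel k) / t"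
          unfolding sum_divide_distrib by (rule sum.cong) auto
        then show "(\<Sum>p\<in>\<D>. measure lborel (snd p) / t) = 1" using total t0 by simp
        show "g (f (fst p)) \<in> S" if "p \<in> \<D>" for p
          using g(1)[OF inP[of "fst p" "snd p"]] that S(3) by auto
      qed (use t0 in simp)
      then have "(t / (\<tau> + 1)) *\<^sub>R z + (1 - t / (\<tau> + 1)) *\<^sub>R 0 \<in> S"
        using S(1,2) t by (intro convexD) (auto simp: divide_le_eq_1)
      then have "(t / (\<tau> + 1)) *\<^sub>R z \<in> S" by simp
      moreover have "J = (\<tau> + 1) *\<^sub>R ((t / (\<tau> + 1)) *\<^sub>R z)"
      proof -
        have "J = t *\<^sub>R z"
          unfolding J_def z_def scaleR_sum_right by (rule sum.cong) (use t0 in auto)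
        then show ?thesis using \<tau> by simp
      qed
      ultimately show ?thesis unfolding C_def by blast
    qed
    ultimately show ?thesis by blast
  qed
  then show "\<exists>C. compact C \<and> (\<forall>p\<in>{integral {0..t} f | t f. 0 \<le> t \<and> t \<le> \<tau> \<and>
      f integrable_on {0..t} \<and> (\<forall>s\<in>{0..t}. f s \<in> P)}. \<exists>c\<in>C. dist p c \<le> e)"
    using C by blast
qed

context strongly_continuous_semigroup
begin

lemma totally_bounded_orbits:
  assumes "totally_bounded S" "\<tau> \<ge> 0"
  shows "totally_bounded {T \<sigma> k | \<sigma> k. 0 \<le> \<sigma> \<and> \<sigma> \<le> \<tau> \<and> k \<in> S}"
proof (rule totally_boundedI)
  fix e :: real assume e: "e > 0"
  obtain M where M: "M \<ge> 1" "\<And>t x. 0 \<le> t \<Longrightarrow> t \<le> \<tau> \<Longrightarrow> norm (T t x) \<le> M * norm x"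
    using T_bounded[OF assms(2)] by blast
  have "e / M > 0" using e M by simp
  then obtain F where F: "finite F" "S \<subseteq> (\<Union>x\<in>F. ball x (e / M))"
    using assms(1) unfolding totally_bounded_def by blast
  define C where "C = (\<Union>x\<in>F. (\<lambda>\<sigma>. T \<sigma> x) ` {0..\<tau>})"
  have "compact C"
    unfolding C_def using F(1)
    by (intro compact_UN compact_continuous_image continuous_on_subset[OF continuous_on_T]) auto
  moreover have "\<exists>c\<in>C. dist (T \<sigma> k) c \<le> e" if \<sigma>: "0 \<le> \<sigma>" "\<sigma> \<le> \<tau>" and k: "k \<in> S" for \<sigma> k
  proof -
    obtain x where x: "x \<in> F" "dist x k < e / M" using F(2) k by auto
    have "dist (T \<sigma> k) (T \<sigma> x) \<le> M * norm (k - x)"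
      using M(2)[OF \<sigma>, of "k - x"] by (simp add: dist_norm T_diff \<sigma>)
    also have "\<dots> \<le> M * (e / M)"
      using x(2) M(1) by (intro mult_left_mono) (auto simp: dist_norm norm_minus_commute)
    also have "\<dots> = e" using M(1) by simp
    finally have "dist (T \<sigma> k) (T \<sigma> x) \<le> e" .
    moreover have "T \<sigma> x \<in> C"
      unfolding C_def using \<sigma> by (intro UN_I[OF x(1)] imageI) simp
    ultimately show ?thesis by blast
  qed
  ultimately show "\<exists>C. compact C \<and> (\<forall>p\<in>{T \<sigma> k | \<sigma> k. 0 \<le> \<sigma> \<and> \<sigma> \<le> \<tau> \<and> k \<in> S}. \<exists>c\<in>C. dist p c \<le> e)"
    by blast
qed

text \<open>Transporting the integral term from time \<open>t\<close> to the fixed time \<open>\<tau>\<close> turns it into the integral over \<open>[0,t]\<close>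
of \<open>T (\<tau> - s) k\<close> with \<open>k\<close> in the precompact set of values of \<open>K\<close> along the solutions.\<close>

lemma totally_bounded_perturbation:
  assumes K: "collectively_compact K"
    and sol: "\<And>x0. x0 \<in> B \<Longrightarrow> is_solution T K x0 (u x0)"
    and bd: "bounded {u x0 t | t x0. 0 \<le> t \<and> t \<le> \<tau> \<and> x0 \<in> B}" and \<tau>: "\<tau> \<ge> 0"
  shows "totally_bounded {T (\<tau> - t) (u x0 t - T t x0) | t x0. 0 \<le> t \<and> t \<le> \<tau> \<and> x0 \<in> B}"
proof -
  define S where "S = (\<lambda>(t, x). K t x) ` ({0..\<tau>} \<times> {u x0 t | t x0. 0 \<le> t \<and> t \<le> \<tau> \<and> x0 \<in> B})"
  have cS: "compact (closure S)"
    using K bd \<tau> unfolding collectively_compact_def S_def by blast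
  have "totally_bounded S"
    by (rule totally_boundedI, rule exI[of _ "closure S"])
      (use cS closure_subset[of S] in \<open>auto intro!: bexI\<close>)
  then have "totally_bounded {T \<sigma> k | \<sigma> k. 0 \<le> \<sigma> \<and> \<sigma> \<le> \<tau> \<and> k \<in> S}" (is "totally_bounded ?P")
    using \<tau> by (rule totally_bounded_orbits)
  from totally_bounded_integrals[OF this \<tau>]
  have tb: "totally_bounded {integral {0..t} f | t f. 0 \<le> t \<and> t \<le> \<tau> \<and> f integrable_on {0..t} \<and> (\<forall>s\<in>{0..t}. f s \<in> ?P)}"
    (is "totally_bounded ?I") .
  have "{T (\<tau> - t) (u x0 t - T t x0) | t x0. 0 \<le> t \<and> t \<le> \<tau> \<and> x0 \<in> B} \<subseteq> ?I"
  proof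
    fix q assume "q \<in> {T (\<tau> - t) (u x0 t - T t x0) | t x0. 0 \<le> t \<and> t \<le> \<tau> \<and> x0 \<in> B}"
    then obtain t x0 where q: "q = T (\<tau> - t) (u x0 t - T t x0)" and t: "0 \<le> t" "t \<le> \<tau>" and x0: "x0 \<in> B"
      by blast
    define f where "f s = T (\<tau> - s) (K s (u x0 s))" for s
    have int: "(\<lambda>s. T (t - s) (K s (u x0 s))) integrable_on {0..t}"
      and eq: "u x0 t - T t x0 = integral {0..t} (\<lambda>s. T (t - s) (K s (u x0 s)))"
      using sol[OF x0] t(1) unfolding is_solution_def by auto
    have lin: "bounded_linear (T (\<tau> - t))" using t by (intro bounded_linear_T) simp
    have "(T (\<tau> - t) \<circ> (\<lambda>s. T (t - s) (K s (u x0 s))) has_integral q) {0..t}"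
      unfolding q eq by (rule has_integral_linear[OF integrable_integral[OF int] lin])
    moreover have "(T (\<tau> - t) \<circ> (\<lambda>s. T (t - s) (K s (u x0 s)))) s = f s" if "s \<in> {0..t}" for s
      using T_add[of "\<tau> - t" "t - s" "K s (u x0 s)"] that t by (simp add: f_def)
    ultimately have hf: "(f has_integral q) {0..t}" by (rule has_integral_eq[rotated])
    have "f s \<in> ?P" if "s \<in> {0..t}" for s
    proof -
      have "K s (u x0 s) \<in> S"
        unfolding S_def
      proof (rule image_eqI[where x="(s, u x0 s)"])
        have "u x0 s \<in> {u x0 t | t x0. 0 \<le> t \<and> t \<le> \<tau> \<and> x0 \<in> B}"
          using that t x0 by (intro CollectI exI[of _ s] exI[of _ x0]) auto
        then show "(s, u x0 s) \<in> {0..\<tau>} \<times> {u x0 t | t x0. 0 \<le> t \<and> t \<le> \<tau> \<and> x0 \<in> B}"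
          using that t by simp
      qed simp
      then show ?thesis unfolding f_def using that t by (intro CollectI exI[of _ "\<tau> - s"] exI conjI) auto
    qed
    then show "q \<in> ?I"
      using t hf integral_unique[OF hf] has_integral_integrable[OF hf] by blast
  qed
  with tb show ?thesis unfolding totally_bounded_def by (meson order_trans)
qed

text \<open>For \<open>t\<close> in \<open>(n - 1, n]\<close>, the vector \<open>T (n - t) (u x0 t)\<close> is \<open>T n x0\<close> plus an element of the totally bounded set
\<open>Q n\<close>, and its norm is at most \<open>M norm (u x0 t)\<close>. So the bound at integer times yields the bound at
all times, with a loss of \<open>M exp \<bar>s\<bar>\<close> that \<open>\<alpha>\<close> accounts for.\<close>

lemma large_orbit:
  fixes a :: "real \<Rightarrow> real"
  assumes K: "collectively_compact K"
    and a: "\<forall>t\<ge>0. a t \<ge> 0" "antimono_on {0..} a" "(a \<longlongrightarrow> 0) at_top"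
    and r: "r > 0" and solv: "bounded_solvability T K (cball y r)"
  shows "\<exists>x0\<in>cball y r. \<exists>x. is_solution T K x0 x \<and>
    (\<exists>t0\<ge>0. \<forall>t\<ge>t0. norm (x t) \<ge> a t * exp_growth (resolvent_bound D A) t)"
proof -
  obtain u where sol: "\<And>x0. x0 \<in> cball y r \<Longrightarrow> is_solution T K x0 (u x0)"
    and bd: "\<And>\<tau>. \<tau> > 0 \<Longrightarrow> bounded {u x0 t | t x0. 0 \<le> t \<and> t \<le> \<tau> \<and> x0 \<in> cball y r}"
    using solv unfolding bounded_solvability_def by blast
  obtain c where c: "c > 0" "resolvent_bound D A < \<infinity>"
    "\<And>s N. resolvent_bound D A = ereal s \<Longrightarrow> separated s c N"
    by (rule separated_below_resolvent_bound) blast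
  show ?thesis
  proof (cases "resolvent_bound D A")
    case PInf
    then show ?thesis using c(2) by simp
  next
    case MInf
    have "y \<in> cball y r" using r by simp
    then show ?thesis using sol MInf by (intro bexI[of _ y] exI[of _ "u y"]) (auto simp: exp_growth_def)
  next
    case (real s)
    define Q where "Q n = {T (real n - t) (u x0 t - T t x0) | t x0. 0 \<le> t \<and> t \<le> real n \<and> x0 \<in> cball y r}"
      for n :: nat
    have Q: "totally_bounded (Q n)" for n
      unfolding Q_def
    proof (rule totally_bounded_perturbation[OF K sol])
      show "bounded {u x0 t | t x0. 0 \<le> t \<and> t \<le> real n \<and> x0 \<in> cball y r}"
        by (rule bounded_subset[OF bd[of "real n + 1"]]) fastforce+
    qed auto
    define V where "V n x = exp (- s * real n) *\<^sub>R T (real n) x" for n x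
    define Q' where "Q' n = (\<lambda>q. 0 + exp (- s * real n) *\<^sub>R q) ` Q n" for n
    obtain M where M: "M \<ge> 1" "\<And>t x. 0 \<le> t \<Longrightarrow> t \<le> 1 \<Longrightarrow> norm (T t x) \<le> M * norm x"
      using T_bounded[of 1] by auto
    define \<alpha> where "\<alpha> n = M * exp \<bar>s\<bar> * a (real (n - 1))" for n :: nat
    have \<alpha>: "\<alpha> \<longlonglongrightarrow> 0"
    proof -
      have "filterlim (\<lambda>n::nat. real (n - 1)) at_top sequentially"
        by (rule filterlim_compose[OF filterlim_real_sequentially filterlim_minus_const_nat_at_top])
      from filterlim_compose[OF a(3) this] have "(\<lambda>n. M * exp \<bar>s\<bar> * a (real (n - 1))) \<longlonglongrightarrow> M * exp \<bar>s\<bar> * 0"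
        by (intro tendsto_intros)
      then show ?thesis by (simp add: \<alpha>_def[abs_def])
    qed
    have V: "bounded_linear (V n)" for n
      unfolding V_def by (intro bounded_linear_scaleR_right[THEN bounded_linear_compose] bounded_linear_T) simp
    have Q': "totally_bounded (Q' n)" for n
      unfolding Q'_def by (rule totally_bounded_affine_image[OF Q])
    have sep: "\<exists>x. (\<forall>i. norm (x i) \<le> 1) \<and>
       (\<forall>i j n. i < j \<longrightarrow> n \<le> N \<longrightarrow> c \<le> norm (V n (x i - x (j::nat))))" for N
    proof -
      obtain x where x: "\<And>i. norm (x i) \<le> 1"
        "\<And>i j n. i < j \<Longrightarrow> n \<le> N \<Longrightarrow> c * exp (s * real n) \<le> norm (T (real n) (x i - x (j::nat)))"
        using c(3)[OF real, of N] unfolding separated_def by blast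
      have "c \<le> norm (V n (x i - x j))" if "i < j" "n \<le> N" for i j n
      proof -
        have "c = exp (- s * real n) * (c * exp (s * real n))" by (simp add: exp_minus)
        also have "\<dots> \<le> exp (- s * real n) * norm (T (real n) (x i - x j))"
          using x(2)[OF that] by (intro mult_left_mono) auto
        finally show ?thesis by (simp add: V_def)
      qed
      with x(1) show ?thesis by blast
    qed
    obtain x0 n0 where x0: "x0 \<in> cball y r"
      "\<And>n q. n \<ge> n0 \<Longrightarrow> q \<in> Q' n \<Longrightarrow> \<alpha> n \<le> norm (V n x0 + q)"
      by (rule orbit_escaping_totally_bounded_sets[where y=y and Q=Q', OF V Q' c(1) sep \<alpha> r]) blast
    have "a t * exp (s * t) \<le> norm (u x0 t)" if t: "t \<ge> real n0 + 1" for t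
    proof -
      define n where "n = nat \<lceil>t\<rceil>"
      have n: "t \<le> real n" "real n < t + 1" using t by (auto simp: n_def) linarith+
      have n1: "n \<ge> n0" "n \<ge> 1" using n t by linarith+
      then have rn: "real (n - 1) = real n - 1" by simp
      define q where "q = T (real n - t) (u x0 t - T t x0)"
      have "q \<in> Q n"
        unfolding Q_def q_def using n t x0(1) by (intro CollectI exI[of _ t] exI[of _ x0]) auto
      then have "exp (- s * real n) *\<^sub>R q \<in> Q' n" by (auto simp: Q'_def)
      from x0(2)[OF n1(1) this] have "\<alpha> n \<le> norm (exp (- s * real n) *\<^sub>R (T (real n) x0 + q))"
        by (simp add: V_def scaleR_add_right)
      moreover have "T (real n) x0 + q = T (real n - t) (u x0 t)"
        using T_add[of "real n - t" t x0] n t by (simp add: q_def T_diff)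
      ultimately have "\<alpha> n \<le> exp (- s * real n) * norm (T (real n - t) (u x0 t))" by simp
      also have "\<dots> \<le> exp (- s * real n) * (M * norm (u x0 t))"
        using n by (intro mult_left_mono M(2)) auto
      finally have le: "\<alpha> n \<le> exp (- s * real n) * (M * norm (u x0 t))" .
      have "a t \<le> a (real (n - 1))"
        using a(2) n t n1(2) by (intro monotone_onD[of "{0..}" "(\<le>)" "(\<ge>)" a]) (auto simp: rn)
      then have "M * exp \<bar>s\<bar> * a t \<le> \<alpha> n" unfolding \<alpha>_def using M(1) by (intro mult_left_mono) auto
      with le have "M * (exp \<bar>s\<bar> * a t) \<le> M * (exp (- s * real n) * norm (u x0 t))"
        by (simp add: algebra_simps)
      then have "exp \<bar>s\<bar> * a t \<le> exp (- s * real n) * norm (u x0 t)" using M(1) by simp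
      then have "exp (s * real n) * (exp \<bar>s\<bar> * a t) \<le> exp (s * real n) * (exp (- s * real n) * norm (u x0 t))"
        by (intro mult_left_mono) auto
      then have "exp (s * real n + \<bar>s\<bar>) * a t \<le> norm (u x0 t)"
        by (simp add: exp_add exp_minus mult.assoc[symmetric])
      moreover have "exp (s * t) * a t \<le> exp (s * real n + \<bar>s\<bar>) * a t"
      proof (rule mult_right_mono)
        have "s * (t - real n) \<le> \<bar>s\<bar> * \<bar>t - real n\<bar>" by (metis abs_ge_self abs_mult)
        also have "\<dots> \<le> \<bar>s\<bar> * 1" using n by (intro mult_left_mono) auto
        finally show "exp (s * t) \<le> exp (s * real n + \<bar>s\<bar>)" by (simp add: algebra_simps)
        show "0 \<le> a t" using a(1) t by simp
      qed
      ultimately show ?thesis by (simp add: mult.commute)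
    qed
    then show ?thesis
      using x0(1) sol[OF x0(1)] real
      by (intro bexI[of _ x0] exI[of _ "u x0"] conjI exI[of _ "real n0 + 1"]) (auto simp: exp_growth_def)
  qed
qed

end

theorem corollary7p9:
  fixes T :: "real \<Rightarrow> 'a::complex_banach \<Rightarrow> 'a"
    and K :: "real \<Rightarrow> 'a \<Rightarrow> 'a"
    and a :: "real \<Rightarrow> real"
    and X0 :: "'a set" and y :: 'a and r :: real
  assumes "\<not> finite_dimensional (UNIV :: 'a set)"
    and "C0_semigroup T"
    and "collectively_compact K" and "separately_continuous K"
    and "\<forall>t\<ge>0. a t \<ge> 0" and "antimono_on {0..} a" and "(a \<longlongrightarrow> 0) at_top"
    and "r > 0" and "cball y r \<subseteq> X0"
    and "bounded_solvability T K (cball y r)"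
  shows "(\<exists>x0\<in>cball y r. \<exists>x. is_solution T K x0 x \<and>
            (\<exists>t0\<ge>0. \<forall>t\<ge>t0. norm (x t) \<ge>
               a t * exp_growth (resolvent_bound (generator_domain T) (generator T)) t)) \<and>
         (X0 = UNIV \<and> (\<forall>B. bounded B \<longrightarrow> bounded_solvability T K B) \<longrightarrow>
            closure {x0. \<exists>x. is_solution T K x0 x \<and>
              (\<exists>t0\<ge>0. \<forall>t\<ge>t0. norm (x t) \<ge>
                 a t * exp_growth (resolvent_bound (generator_domain T) (generator T)) t)} = UNIV)"
proof (intro conjI impI)
  interpret strongly_continuous_semigroup T by standard fact
  note large = large_orbit[OF assms(3,5,6,7)]
  show "\<exists>x0\<in>cball y r. \<exists>x. is_solution T K x0 x \<and>
      (\<exists>t0\<ge>0. \<forall>t\<ge>t0. norm (x t) \<ge> a t * exp_growth (resolvent_bound D A) t)"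
    by (rule large[OF assms(8,10)])
  assume all: "X0 = UNIV \<and> (\<forall>B. bounded B \<longrightarrow> bounded_solvability T K B)"
  let ?G = "{x0. \<exists>x. is_solution T K x0 x \<and>
      (\<exists>t0\<ge>0. \<forall>t\<ge>t0. norm (x t) \<ge> a t * exp_growth (resolvent_bound D A) t)}"
  have "z \<in> closure ?G" for z
    unfolding closure_approachable
  proof (intro allI impI)
    fix e :: real assume "e > 0"
    then have "e / 2 > 0" "bounded_solvability T K (cball z (e / 2))" using all by auto
    from large[OF this] obtain x0 where "x0 \<in> cball z (e / 2)" "x0 \<in> ?G" by blast
    then show "\<exists>x0\<in>?G. dist x0 z < e"
      using \<open>e > 0\<close> by (intro bexI[of _ x0]) (auto simp: dist_commute)
  qed
  then show "closure ?G = UNIV" by blast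
qed

end
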